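(* Let $K\subseteq F_1$ and $K\subseteq F_2$ be field extensions, and let $Q$ be the prime field of $K$. Suppose that $F_2$ contains an algebraic closure $\bar{Q}$ of $Q$. Let $A$ and $B$ be two finite-dimensional $K$-algebras whose structure constants, relative to suitable bases, lie in $\bar{Q}$. If $A_{F_1}\cong B_{F_1}$ as $F_1$-algebras, then $A_{F_2}\cong B_{F_2}$ as $F_2$-algebras.
   Context: Algebras are not necessarily associative, commutative or unital. For a $K$-algebra $A$ and a field extension $K\subseteq F$, $A_F:=A\otimes_K F$, regarded as an $F$-algebra. The structure constants of $A$ relative to a $K$-basis $\{e_i\}_{i\in\Lambda}$ are the elements $\gamma_{ij}^k\in K$ with $e_ie_j=\sum_{k\in\Lambda}\gamma_{ij}^k e_k$. Here $K$ and $\bar{Q}$ are both viewed as subfields of $F_2$, so the hypothesis says that the structure constants are in $K\cap\bar{Q}$, i.e. are elements of $K$ algebraic over $Q$. *)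

theory Defs
  imports
    "HOL-Algebra.Free_Abelian_Groups"
    "HOL-Algebra.Algebraic_Closure"
    "Jordan_Normal_Form.VS_Connect"
begin

text \<open>
  Algebras are not assumed associative, commutative or unital. The record type \<open>module\<close> of
  \<open>HOL-Algebra\<close> provides the operations; its field \<open>one\<close> is left unconstrained and is never used.
\<close>

locale nonassoc_algebra = vectorspace K A for K and A (structure) +
  assumes mult_closed: "\<lbrakk>x \<in> carrier A; y \<in> carrier A\<rbrakk> \<Longrightarrow> x \<otimes> y \<in> carrier A"
    and mult_add_left:
      "\<lbrakk>x \<in> carrier A; y \<in> carrier A; z \<in> carrier A\<rbrakk> \<Longrightarrow> (x \<oplus> y) \<otimes> z = (x \<otimes> z) \<oplus> (y \<otimes> z)"
    and mult_add_right:
      "\<lbrakk>x \<in> carrier A; y \<in> carrier A; z \<in> carrier A\<rbrakk> \<Longrightarrow> x \<otimes> (y \<oplus> z) = (x \<otimes> y) \<oplus> (x \<otimes> z)"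
    and mult_smult_left:
      "\<lbrakk>c \<in> carrier K; x \<in> carrier A; y \<in> carrier A\<rbrakk> \<Longrightarrow> (c \<odot> x) \<otimes> y = c \<odot> (x \<otimes> y)"
    and mult_smult_right:
      "\<lbrakk>c \<in> carrier K; x \<in> carrier A; y \<in> carrier A\<rbrakk> \<Longrightarrow> x \<otimes> (c \<odot> y) = c \<odot> (x \<otimes> y)"

definition algebra_isomorphic ::
    "('k, 'm) ring_scheme \<Rightarrow> ('k, 'a, 'p) module_scheme \<Rightarrow> ('k, 'b, 'q) module_scheme \<Rightarrow> bool" where
  "algebra_isomorphic K A B \<longleftrightarrow>
     (\<exists>h \<in> module_hom K A B. bij_betw h (carrier A) (carrier B) \<and>
        (\<forall>x \<in> carrier A. \<forall>y \<in> carrier A. h (x \<otimes>\<^bsub>A\<^esub> y) = h x \<otimes>\<^bsub>B\<^esub> h y))"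

text \<open>
  A basis is a set, as in \<^const>\<open>vectorspace.basis\<close>, so structure constants are indexed by the basis
  vectors themselves: \<open>\<gamma> e e' e''\<close> is the coefficient of \<open>e''\<close> in the product \<open>e e'\<close>.
\<close>

definition structure_constants ::
    "('k, 'm) ring_scheme \<Rightarrow> ('k, 'a, 'p) module_scheme \<Rightarrow> 'a set \<Rightarrow> ('a \<Rightarrow> 'a \<Rightarrow> 'a \<Rightarrow> 'k) \<Rightarrow> bool" where
  "structure_constants K A E \<gamma> \<longleftrightarrow>
     (\<forall>e \<in> E. \<forall>e' \<in> E. (\<forall>e'' \<in> E. \<gamma> e e' e'' \<in> carrier K) \<and>
        e \<otimes>\<^bsub>A\<^esub> e' = (\<Oplus>\<^bsub>A\<^esub> e'' \<in> E. \<gamma> e e' e'' \<odot>\<^bsub>A\<^esub> e''))"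

definition prime_field :: "('k, 'm) ring_scheme \<Rightarrow> 'k set" where
  "prime_field K = \<Inter> {S. subfield S K}"

text \<open>
  A field extension is a ring homomorphism \<open>\<iota>\<close> from \<open>K\<close> to \<open>F\<close>. The tensor product of \<open>A\<close> and \<open>F\<close> over
  \<open>K\<close> is the free abelian group on pairs \<open>(a, r)\<close>, modulo the subgroup generated by the relators
  below; its elements are cosets, and \<open>(a, r)\<close> represents the pure tensor of \<open>a\<close> and \<open>r\<close>.
\<close>

definition tensor_relators ::
    "('k, 'm) ring_scheme \<Rightarrow> ('f, 'n) ring_scheme \<Rightarrow> ('k \<Rightarrow> 'f) \<Rightarrow> ('k, 'a, 'p) module_scheme \<Rightarrow>
     ('a \<times> 'f \<Rightarrow>\<^sub>0 int) set" where
  "tensor_relators K F \<iota> A =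
     {frag_of (a \<oplus>\<^bsub>A\<^esub> b, r) - frag_of (a, r) - frag_of (b, r) | a b r.
        a \<in> carrier A \<and> b \<in> carrier A \<and> r \<in> carrier F} \<union>
     {frag_of (a, r \<oplus>\<^bsub>F\<^esub> s) - frag_of (a, r) - frag_of (a, s) | a r s.
        a \<in> carrier A \<and> r \<in> carrier F \<and> s \<in> carrier F} \<union>
     {frag_of (c \<odot>\<^bsub>A\<^esub> a, r) - frag_of (a, \<iota> c \<otimes>\<^bsub>F\<^esub> r) | c a r.
        c \<in> carrier K \<and> a \<in> carrier A \<and> r \<in> carrier F}"

definition tensor_null ::
    "('k, 'm) ring_scheme \<Rightarrow> ('f, 'n) ring_scheme \<Rightarrow> ('k \<Rightarrow> 'f) \<Rightarrow> ('k, 'a, 'p) module_scheme \<Rightarrow>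
     ('a \<times> 'f \<Rightarrow>\<^sub>0 int) set" where
  "tensor_null K F \<iota> A =
     generate (free_Abelian_group (carrier A \<times> carrier F)) (tensor_relators K F \<iota> A)"

text \<open>
  The \<open>F\<close>-algebra structure is induced from the \<open>\<int>\<close>-bilinear product extending
  \<open>(a, r) (b, s) = (a b, r s)\<close> and the additive maps extending \<open>c (a, r) = (a, c r)\<close> on the free abelian
  group. As for \<^const>\<open>rcoset_mult\<close>, an operation on cosets is the union of the cosets of the results
  over all representatives; these cosets coincide when \<open>A\<close> is an algebra over the field \<open>K\<close>.
\<close>

definition scalar_extension ::
    "('k, 'm) ring_scheme \<Rightarrow> ('f, 'n) ring_scheme \<Rightarrow> ('k \<Rightarrow> 'f) \<Rightarrow> ('k, 'a, 'p) module_scheme \<Rightarrow>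
     ('f, ('a \<times> 'f \<Rightarrow>\<^sub>0 int) set) module" where
  "scalar_extension K F \<iota> A =
     (let G = free_Abelian_group (carrier A \<times> carrier F); N = tensor_null K F \<iota> A in
      \<lparr>carrier = carrier (G Mod N),
       monoid.mult = (\<lambda>S T. \<Union>x\<in>S. \<Union>y\<in>T. N #>\<^bsub>G\<^esub>
         frag_extend (\<lambda>(a, r). frag_extend (\<lambda>(b, s). frag_of (a \<otimes>\<^bsub>A\<^esub> b, r \<otimes>\<^bsub>F\<^esub> s)) y) x),
       one = undefined,
       zero = \<one>\<^bsub>G Mod N\<^esub>,
       add = (\<lambda>S T. S \<otimes>\<^bsub>G Mod N\<^esub> T),
       smult = (\<lambda>c S. \<Union>x\<in>S. N #>\<^bsub>G\<^esub> frag_extend (\<lambda>(a, r). frag_of (a, c \<otimes>\<^bsub>F\<^esub> r)) x)\<rparr>)"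

end

theory Submission
  imports Defs
begin

text \<open>
  With bases fixed, an isomorphism between two finite-dimensional algebras is a pair of mutually
  inverse matrices \<open>P\<close>, \<open>Q\<close> subject to finitely many polynomial equations whose coefficients are the
  structure constants. Here these constants lie in the subfield \<open>K\<^sub>0\<close> of elements of \<open>K\<close> that \<open>\<iota>\<^sub>2\<close> sends
  into \<open>Qbar\<close>. So the hypothesis says that a polynomial system over \<open>K\<^sub>0\<close> has a solution in the
  extension \<open>F\<^sub>1\<close> of \<open>K\<^sub>0\<close>, and it must be shown to have one in the algebraically closed extension
  \<open>Qbar\<close> of \<open>K\<^sub>0\<close>, which is contained in \<open>F\<^sub>2\<close>. This is the weak Nullstellensatz.

  The form used is \<open>subfield_hom_extension\<close>: a homomorphism from a subfield of \<open>F\<^sub>1\<close> to an algebraically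
  closed field extends to a subring containing any given finite set. Applying such an extension to the
  entries of \<open>P\<close> and \<open>Q\<close> gives matrices over \<open>Qbar\<close> solving the same equations
  (\<open>isomorphism_matrices_transfer\<close>). The extension is built by adjoining one element at a time. A
  homomorphism on a subring \<open>R\<close> that is not a field need not extend to \<open>R[x]\<close>, but it does if it avoids
  killing one suitable nonzero \<open>u \<in> R\<close>, and \<open>u\<close> can be chosen so that moreover a prescribed nonzero
  \<open>v \<in> R[x]\<close> is not killed (\<open>adjoin_hom_extension\<close>). This stronger form iterates, and over a field the
  condition on \<open>u\<close> is void.

  The link with the tensor products is that the coordinates of a formal sum of pairs \<open>(a, r)\<close> determine
  its class in \<open>A \<otimes> F\<close>: the cosets are precisely the fibres of the coordinate map on the free abelian
  group. Hence \<open>A \<otimes> F\<close> is isomorphic to the algebra of coordinate vectors over \<open>F\<close> with the images of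
  the structure constants of \<open>A\<close> (\<open>scalar_extension_iso_coordinates\<close>).
\<close>

section \<open>Subrings of a ring and polynomials over them\<close>

definition is_subring :: "'a::comm_ring_1 set \<Rightarrow> bool" where
  "is_subring R \<longleftrightarrow> 1 \<in> R \<and> (\<forall>x\<in>R. \<forall>y\<in>R. x - y \<in> R \<and> x * y \<in> R)"

definition polys_over :: "'a::comm_ring_1 set \<Rightarrow> 'a poly set" where
  "polys_over R = {p. \<forall>i. Polynomial.coeff p i \<in> R}"

text \<open>
  The homomorphism is a total function, of which only the values on \<open>R\<close> matter; \<open>S\<close> is a set bounding
  the image.
\<close>

definition subring_hom :: "'a::comm_ring_1 set \<Rightarrow> 'b::comm_ring_1 set \<Rightarrow> ('a \<Rightarrow> 'b) \<Rightarrow> bool" where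
  "subring_hom R S f \<longleftrightarrow> is_subring R \<and> f ` R \<subseteq> S \<and> f 1 = 1 \<and>
     (\<forall>x\<in>R. \<forall>y\<in>R. f (x + y) = f x + f y \<and> f (x * y) = f x * f y)"

text \<open>
  Inside a field, roots of the polynomials \<open>a X - 1\<close> provide inverses, so such a set is then an
  algebraically closed subfield.
\<close>

definition root_closed_subring :: "'a::comm_ring_1 set \<Rightarrow> bool" where
  "root_closed_subring S \<longleftrightarrow> is_subring S \<and>
     (\<forall>p\<in>polys_over S. Polynomial.degree p > 0 \<longrightarrow> (\<exists>x\<in>S. poly p x = 0))"

definition adjoin :: "'a::comm_ring_1 set \<Rightarrow> 'a \<Rightarrow> 'a set" where
  "adjoin R x = {poly p x | p. p \<in> polys_over R}"

lemma subring_closed: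
  assumes "is_subring R"
  shows subring_one: "1 \<in> R" and subring_zero: "0 \<in> R"
    and subring_diff: "\<And>x y. x \<in> R \<Longrightarrow> y \<in> R \<Longrightarrow> x - y \<in> R"
    and subring_mult: "\<And>x y. x \<in> R \<Longrightarrow> y \<in> R \<Longrightarrow> x * y \<in> R"
    and subring_uminus: "\<And>x. x \<in> R \<Longrightarrow> - x \<in> R"
    and subring_add: "\<And>x y. x \<in> R \<Longrightarrow> y \<in> R \<Longrightarrow> x + y \<in> R"
proof -
  show 1: "1 \<in> R" and d: "\<And>x y. x \<in> R \<Longrightarrow> y \<in> R \<Longrightarrow> x - y \<in> R"
    and "\<And>x y. x \<in> R \<Longrightarrow> y \<in> R \<Longrightarrow> x * y \<in> R"
    using assms by (auto simp: is_subring_def)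
  show 0: "0 \<in> R" using d[OF 1 1] by simp
  show m: "- x \<in> R" if "x \<in> R" for x using d[OF 0 that] by simp
  show "x + y \<in> R" if "x \<in> R" "y \<in> R" for x y using d[OF that(1) m[OF that(2)]] by simp
qed

lemma subring_sum:
  assumes "is_subring R" "\<And>i. i \<in> I \<Longrightarrow> h i \<in> R" shows "sum h I \<in> R"
  using assms(2)
  by (induction I rule: infinite_finite_induct)
    (simp_all add: subring_zero[OF assms(1)] subring_add[OF assms(1)])

lemma subring_power: "is_subring R \<Longrightarrow> x \<in> R \<Longrightarrow> x ^ n \<in> R"
  by (induction n) (auto intro: subring_one subring_mult)

lemma subring_poly:
  assumes "is_subring R" "p \<in> polys_over R" "x \<in> R" shows "poly p x \<in> R"
  unfolding poly_altdef using assms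
  by (intro subring_sum subring_mult subring_power) (auto simp: polys_over_def)

lemma polys_over_closed:
  assumes "is_subring R"
  shows is_subring_polys_over: "is_subring (polys_over R)"
    and polys_over_smult: "\<And>c p. c \<in> R \<Longrightarrow> p \<in> polys_over R \<Longrightarrow> Polynomial.smult c p \<in> polys_over R"
    and polys_over_monom: "\<And>c n. c \<in> R \<Longrightarrow> Polynomial.monom c n \<in> polys_over R"
    and polys_over_pCons: "\<And>c p. c \<in> R \<Longrightarrow> p \<in> polys_over R \<Longrightarrow> pCons c p \<in> polys_over R"
  using assms unfolding is_subring_def[of "polys_over R"]
  by (auto simp: polys_over_def coeff_mult coeff_pCons split: nat.split
      intro!: subring_sum subring_mult subring_diff subring_zero subring_one)

lemma subring_adjoin:
  assumes R: "is_subring R"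
  shows is_subring_adjoin: "is_subring (adjoin R x)"
    and adjoin_base: "R \<subseteq> adjoin R x" and adjoin_gen: "x \<in> adjoin R x"
proof -
  note P = is_subring_polys_over[OF R]
  show "is_subring (adjoin R x)"
    unfolding is_subring_def
  proof (intro conjI ballI)
    show "1 \<in> adjoin R x"
      unfolding adjoin_def using subring_one[OF P] by (metis (mono_tags, lifting) mem_Collect_eq poly_1)
  next
    fix a b assume "a \<in> adjoin R x" "b \<in> adjoin R x"
    then obtain p q where "p \<in> polys_over R" "a = poly p x" "q \<in> polys_over R" "b = poly q x"
      by (auto simp: adjoin_def)
    then show "a - b \<in> adjoin R x" "a * b \<in> adjoin R x"
      unfolding adjoin_def using subring_diff[OF P, of p q] subring_mult[OF P, of p q]
      by (metis (mono_tags, lifting) mem_Collect_eq poly_diff, metis (mono_tags, lifting) mem_Collect_eq poly_mult)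
  qed
  show "R \<subseteq> adjoin R x"
  proof
    fix r assume "r \<in> R"
    then have "[:r:] \<in> polys_over R" "poly [:r:] x = r"
      using polys_over_pCons[OF R _ subring_zero[OF P]] by auto
    then show "r \<in> adjoin R x" unfolding adjoin_def by (metis (mono_tags, lifting) mem_Collect_eq)
  qed
  have "[:0, 1:] \<in> polys_over R" "poly [:0, 1:] x = x"
    using polys_over_pCons[OF R] subring_zero[OF P] subring_zero[OF R] subring_one[OF R] by auto
  then show "x \<in> adjoin R x" unfolding adjoin_def by (metis (mono_tags, lifting) mem_Collect_eq)
qed

lemma subring_homD:
  assumes "subring_hom R S f"
  shows "is_subring R" "f 0 = 0" "f 1 = 1" "\<And>x. x \<in> R \<Longrightarrow> f x \<in> S"
    "\<And>x y. x \<in> R \<Longrightarrow> y \<in> R \<Longrightarrow> f (x + y) = f x + f y"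
    "\<And>x y. x \<in> R \<Longrightarrow> y \<in> R \<Longrightarrow> f (x * y) = f x * f y"
proof -
  show R: "is_subring R" and "f 1 = 1" "\<And>x. x \<in> R \<Longrightarrow> f x \<in> S"
    and a: "\<And>x y. x \<in> R \<Longrightarrow> y \<in> R \<Longrightarrow> f (x + y) = f x + f y"
    and "\<And>x y. x \<in> R \<Longrightarrow> y \<in> R \<Longrightarrow> f (x * y) = f x * f y"
    using assms by (auto simp: subring_hom_def)
  show "f 0 = 0" using a[OF subring_zero[OF R] subring_zero[OF R]] by simp
qed

lemma subring_hom_sum:
  assumes f: "subring_hom R S f" and h: "\<And>i. i \<in> I \<Longrightarrow> h i \<in> R"
  shows "f (sum h I) = (\<Sum>i\<in>I. f (h i))"
  using h
proof (induction I rule: infinite_finite_induct)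
  case (insert i I)
  then have "sum h I \<in> R" by (intro subring_sum subring_homD(1)[OF f]) auto
  with insert show ?case by (simp add: subring_homD[OF f])
qed (auto simp: subring_homD[OF f])

lemma map_poly_subring_hom:
  assumes f: "subring_hom R S f"
  shows "subring_hom (polys_over R) (polys_over S) (map_poly f)"
proof -
  note D = subring_homD[OF f]
  note c = coeff_map_poly[of f, OF D(2)]
  have "map_poly f (p * q) = map_poly f p * map_poly f q" if "p \<in> polys_over R" "q \<in> polys_over R" for p q
  proof (rule poly_eqI)
    fix n
    have "f (\<Sum>i\<le>n. Polynomial.coeff p i * Polynomial.coeff q (n - i))
        = (\<Sum>i\<le>n. f (Polynomial.coeff p i * Polynomial.coeff q (n - i)))"
      using that by (intro subring_hom_sum[OF f]) (auto simp: polys_over_def intro: subring_mult D(1))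
    also have "\<dots> = (\<Sum>i\<le>n. f (Polynomial.coeff p i) * f (Polynomial.coeff q (n - i)))"
      using that by (intro sum.cong) (auto simp: polys_over_def D)
    finally show "Polynomial.coeff (map_poly f (p * q)) n = Polynomial.coeff (map_poly f p * map_poly f q) n"
      by (simp add: c coeff_mult)
  qed
  moreover have "map_poly f (p + q) = map_poly f p + map_poly f q" if "p \<in> polys_over R" "q \<in> polys_over R" for p q
    using that by (intro poly_eqI) (auto simp: c polys_over_def D)
  moreover have "map_poly f 1 = 1" by (simp add: D(2,3))
  ultimately show ?thesis
    unfolding subring_hom_def using is_subring_polys_over[OF D(1)] by (auto simp: polys_over_def c D)
qed

lemma map_poly_smult_subring_hom:
  assumes f: "subring_hom R S f" and "c \<in> R" "p \<in> polys_over R"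
  shows "map_poly f (Polynomial.smult c p) = Polynomial.smult (f c) (map_poly f p)"
  using assms(2,3) by (intro poly_eqI) (auto simp: coeff_map_poly subring_homD[OF f] polys_over_def)

text \<open>
  Division with remainder over a subring needs no inverse of the leading coefficient of the divisor if
  the dividend is first multiplied by a power of it. The powers of that coefficient are what a
  homomorphism must not kill in order to carry such a division over to its image.
\<close>

lemma pseudo_division_over:
  fixes p q :: "'a::idom poly"
  assumes R: "is_subring R" and q: "q \<in> polys_over R" "q \<noteq> 0" and p: "p \<in> polys_over R"
  shows "\<exists>k s r. s \<in> polys_over R \<and> r \<in> polys_over R \<and>
    Polynomial.smult (lead_coeff q ^ k) p = q * s + r \<and> (r = 0 \<or> Polynomial.degree r < Polynomial.degree q)"
  using p
proof (induction "Polynomial.degree p" arbitrary: p rule: less_induct)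
  case less
  note P = is_subring_polys_over[OF R]
  show ?case
  proof (cases "p = 0 \<or> Polynomial.degree p < Polynomial.degree q")
    case True
    then show ?thesis using less(2) subring_zero[OF P]
      by (intro exI[of _ 0] exI[of _ 0] exI[of _ p]) auto
  next
    case False
    define a where "a = lead_coeff q"
    define m where "m = Polynomial.monom (lead_coeff p) (Polynomial.degree p - Polynomial.degree q)"
    define p' where "p' = Polynomial.smult a p - q * m"
    have a: "a \<in> R" "a \<noteq> 0" using q by (auto simp: a_def polys_over_def)
    have "lead_coeff p \<in> R" using less(2) by (simp add: polys_over_def)
    then have m: "m \<in> polys_over R" unfolding m_def by (rule polys_over_monom[OF R])
    have m0: "m \<noteq> 0" using False by (simp add: m_def)
    have p': "p' \<in> polys_over R"
      unfolding p'_def using less(2) q(1) m a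
      by (intro subring_diff[OF P] subring_mult[OF P] polys_over_smult[OF R])
    have deg: "Polynomial.degree (q * m) = Polynomial.degree p"
      using False m0 q by (simp add: degree_mult_eq) (simp add: m_def degree_monom_eq)
    have lc: "Polynomial.coeff p' (Polynomial.degree p) = 0"
    proof -
      have "Polynomial.coeff (q * m) (Polynomial.degree p) = a * lead_coeff p"
        using deg by (metis a_def lead_coeff_monom lead_coeff_mult m_def)
      then show ?thesis by (simp add: p'_def)
    qed
    have le: "Polynomial.degree p' \<le> Polynomial.degree p"
      unfolding p'_def using deg by (intro degree_diff_le) (auto simp: degree_smult_le)
    show ?thesis
    proof (cases "p' = 0")
      case True
      then have "Polynomial.smult (a ^ 1) p = q * m + 0" by (simp add: p'_def)
      then show ?thesis using m subring_zero[OF P] unfolding a_def by blast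
    next
      case False
      then have "Polynomial.degree p' < Polynomial.degree p" using lc le by (metis leading_coeff_0_iff nless_le)
      from less(1)[OF this p'] obtain k s r where *: "s \<in> polys_over R" "r \<in> polys_over R"
        "Polynomial.smult (a ^ k) p' = q * s + r" "r = 0 \<or> Polynomial.degree r < Polynomial.degree q"
        unfolding a_def by blast
      have "Polynomial.smult (a ^ Suc k) p = Polynomial.smult (a ^ k) p' + q * Polynomial.smult (a ^ k) m"
        by (simp add: p'_def smult_diff_right mult.commute)
      also have "\<dots> = q * (s + Polynomial.smult (a ^ k) m) + r" by (simp add: *(3) algebra_simps)
      finally have "Polynomial.smult (a ^ Suc k) p = q * (s + Polynomial.smult (a ^ k) m) + r" .
      moreover have "s + Polynomial.smult (a ^ k) m \<in> polys_over R"
        using * m a by (intro subring_add[OF P] polys_over_smult[OF R] subring_power[OF R])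
      ultimately show ?thesis using * unfolding a_def by blast
    qed
  qed
qed

section \<open>Extending homomorphisms to finitely generated overrings\<close>

text \<open>
  Sending \<open>x\<close> to \<open>\<xi>\<close> is well defined on \<open>R[x]\<close> as soon as every algebraic relation of \<open>x\<close> over \<open>R\<close> is,
  after applying \<open>f\<close>, a relation of \<open>\<xi>\<close>: two polynomials representing the same element differ by such
  a relation.
\<close>

lemma subring_hom_extend_adjoin:
  assumes f: "subring_hom R S f" and S: "is_subring S" and \<xi>: "\<xi> \<in> S"
    and rel: "\<And>q. q \<in> polys_over R \<Longrightarrow> poly q x = 0 \<Longrightarrow> poly (map_poly f q) \<xi> = 0"
  shows "\<exists>g. subring_hom (adjoin R x) S g \<and> (\<forall>r\<in>R. g r = f r) \<and>
    (\<forall>p\<in>polys_over R. g (poly p x) = poly (map_poly f p) \<xi>)"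
proof -
  note R = subring_homD(1)[OF f]
  note P = is_subring_polys_over[OF R]
  note F = subring_homD[OF map_poly_subring_hom[OF f]]
  define g where "g y = poly (map_poly f (SOME p. p \<in> polys_over R \<and> poly p x = y)) \<xi>" for y
  have g: "g (poly p x) = poly (map_poly f p) \<xi>" if p: "p \<in> polys_over R" for p
  proof -
    define p' where "p' = (SOME p'. p' \<in> polys_over R \<and> poly p' x = poly p x)"
    have p': "p' \<in> polys_over R" "poly p' x = poly p x"
      using someI[of "\<lambda>p'. p' \<in> polys_over R \<and> poly p' x = poly p x" p] p by (auto simp: p'_def)
    have d: "p' - p \<in> polys_over R" using subring_diff[OF P p'(1) p] .
    have "poly (map_poly f (p' - p)) \<xi> = 0" using p' d by (intro rel) auto
    moreover have "map_poly f p' = map_poly f (p' - p) + map_poly f p"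
      using F(5)[OF d p] by simp
    ultimately show ?thesis unfolding g_def p'_def[symmetric] by simp
  qed
  have const: "[:r:] \<in> polys_over R" if "r \<in> R" for r
    using polys_over_pCons[OF R that subring_zero[OF P]] .
  have gR: "g r = f r" if "r \<in> R" for r
    using g[OF const[OF that]] subring_homD(2)[OF f] by (simp add: map_poly_pCons)
  have "subring_hom (adjoin R x) S g"
    unfolding subring_hom_def
  proof (intro conjI ballI)
    show "is_subring (adjoin R x)" by (rule is_subring_adjoin[OF R])
    show "g 1 = 1" using gR[OF subring_one[OF R]] subring_homD(3)[OF f] by simp
    show "g ` adjoin R x \<subseteq> S"
      using g F(4) subring_poly[OF S _ \<xi>] by (auto simp: adjoin_def)
  next
    fix a b assume "a \<in> adjoin R x" "b \<in> adjoin R x"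
    then obtain p q where pq: "p \<in> polys_over R" "a = poly p x" "q \<in> polys_over R" "b = poly q x"
      by (auto simp: adjoin_def)
    show "g (a + b) = g a + g b"
      using g[OF subring_add[OF P pq(1,3)]] g[OF pq(1)] g[OF pq(3)] F(5)[OF pq(1,3)] by (simp add: pq)
    show "g (a * b) = g a * g b"
      using g[OF subring_mult[OF P pq(1,3)]] g[OF pq(1)] g[OF pq(3)] F(6)[OF pq(1,3)] by (simp add: pq)
  qed
  then show ?thesis using gR g by blast
qed

text \<open>
  If \<open>S\<close> were finite, the product of all \<open>X - a\<close> with \<open>a \<in> S\<close>, increased by \<open>1\<close>, would have no root in \<open>S\<close>.
\<close>

lemma infinite_root_closed_subring:
  fixes S :: "'a::idom set"
  assumes "root_closed_subring S" shows "infinite S"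
proof
  assume fin: "finite S"
  have S: "is_subring S" using assms by (simp add: root_closed_subring_def)
  note P = is_subring_polys_over[OF S]
  define p where "p = (\<Prod>a\<in>S. [:- a, 1:])"
  have lin: "[:- a, 1:] \<in> polys_over S" if "a \<in> S" for a
    using polys_over_pCons[OF S subring_uminus[OF S that] subring_one[OF P]] by (simp add: one_pCons)
  have "(\<Prod>a\<in>Z. [:- a, 1:]) \<in> polys_over S" if "Z \<subseteq> S" for Z
    using finite_subset[OF that fin] that
  proof (induction Z)
    case (insert b Z)
    then show ?case using subring_mult[OF P lin[of b]] by (simp del: mult_pCons_left)
  qed (simp add: subring_one[OF P])
  then have p: "p \<in> polys_over S" by (simp add: p_def)
  have "Polynomial.degree p = card S"
    unfolding p_def by (subst degree_prod_eq_sum_degree) auto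
  then have "Polynomial.degree p > 0" using fin subring_one[OF S] card_gt_0_iff by auto
  then have "Polynomial.degree (p + 1) > 0" by (simp add: degree_add_eq_left)
  moreover have "p + 1 \<in> polys_over S" using subring_add[OF P p subring_one[OF P]] .
  ultimately obtain x where "x \<in> S" "poly (p + 1) x = 0"
    using assms by (auto simp: root_closed_subring_def)
  moreover have "poly p x = 0" if "x \<in> S" using that fin by (simp add: p_def poly_prod prod_zero_iff)
  ultimately show False by simp
qed

text \<open>
  If \<open>x\<close> is transcendental over \<open>R\<close>, write \<open>v = w(x)\<close> and let \<open>u\<close> be the leading coefficient of \<open>w\<close>:
  then the image of \<open>w\<close> is a nonzero polynomial, and \<open>x\<close> may be sent to any of the infinitely many
  elements of \<open>S\<close> that are not roots of it.

  If \<open>x\<close> is algebraic over \<open>R\<close>, let \<open>p\<close> be a relation of least degree, with leading coefficient \<open>a\<close>.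
  Pseudo-division by \<open>p\<close> shows that every relation of \<open>x\<close> becomes a multiple of \<open>p\<close> after multiplication
  by a power of \<open>a\<close>. So if \<open>a\<close> is not killed, \<open>x\<close> may be sent to any root of the image of \<open>p\<close>. To keep
  \<open>v\<close> alive, one finds a nonzero multiple \<open>c \<in> R\<close> of \<open>v\<close> in \<open>R[x]\<close> and takes \<open>u = a c\<close>. Such a \<open>c\<close> plays
  the role of a resultant: it is a polynomial \<open>d\<close> of least degree with nonzero value in \<open>v R[x]\<close>, and
  pseudo-division of \<open>p\<close> by \<open>d\<close> forces \<open>d\<close> to be constant.
\<close>

lemma adjoin_hom_extension:
  fixes R :: "'a::idom set" and S :: "'b::idom set"
  assumes R: "is_subring R" and S: "root_closed_subring S" and v: "v \<in> adjoin R x" "v \<noteq> 0"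
  shows "\<exists>u\<in>R. u \<noteq> 0 \<and> (\<forall>f. subring_hom R S f \<longrightarrow> f u \<noteq> 0 \<longrightarrow>
    (\<exists>g. subring_hom (adjoin R x) S g \<and> (\<forall>r\<in>R. g r = f r) \<and> g v \<noteq> 0))"
proof -
  have S': "is_subring S" using S by (simp add: root_closed_subring_def)
  note P = is_subring_polys_over[OF R]
  obtain w where w: "w \<in> polys_over R" "v = poly w x" using v by (auto simp: adjoin_def)
  define ann where "ann = {p \<in> polys_over R. p \<noteq> 0 \<and> poly p x = 0}"
  show ?thesis
  proof (cases "ann = {}")
    case True
    have w0: "w \<noteq> 0" using v w by auto
    show ?thesis
    proof (intro bexI[of _ "lead_coeff w"] conjI allI impI)
      show "lead_coeff w \<in> R" using w by (simp add: polys_over_def)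
      show "lead_coeff w \<noteq> 0" using w0 by simp
      fix f assume f: "subring_hom R S f" and fu: "f (lead_coeff w) \<noteq> 0"
      have "Polynomial.coeff (map_poly f w) (Polynomial.degree w) \<noteq> 0"
        using fu subring_homD(2)[OF f] by (simp add: coeff_map_poly)
      then have "map_poly f w \<noteq> 0" by auto
      then have "finite {z. poly (map_poly f w) z = 0}" by (rule poly_roots_finite)
      then obtain \<xi> where \<xi>: "\<xi> \<in> S" "poly (map_poly f w) \<xi> \<noteq> 0"
        using infinite_root_closed_subring[OF S] by (metis (mono_tags) finite_subset mem_Collect_eq subsetI)
      have "poly (map_poly f q) \<xi> = 0" if "q \<in> polys_over R" "poly q x = 0" for q
        using that True by (cases "q = 0") (auto simp: ann_def)
      from subring_hom_extend_adjoin[OF f S' \<xi>(1) this] \<xi>(2) w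
      show "\<exists>g. subring_hom (adjoin R x) S g \<and> (\<forall>r\<in>R. g r = f r) \<and> g v \<noteq> 0" by metis
    qed
  next
    case False
    then obtain p where p: "p \<in> ann" and min: "\<And>q. q \<in> ann \<Longrightarrow> Polynomial.degree p \<le> Polynomial.degree q"
      using ex_has_least_nat[of "\<lambda>q. q \<in> ann" _ Polynomial.degree] by blast
    have pR: "p \<in> polys_over R" "p \<noteq> 0" "poly p x = 0" using p by (auto simp: ann_def)
    have small0: "r = 0" if "r \<in> polys_over R" "poly r x = 0" "Polynomial.degree r < Polynomial.degree p" for r
      using min[of r] that by (auto simp: ann_def)
    have degp: "Polynomial.degree p > 0"
    proof (rule ccontr)
      assume "\<not> ?thesis"
      then obtain c where "p = [:c:]" by (meson degree_0_id degree_eq_zeroE neq0_conv)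
      then show False using pR by simp
    qed
    define a where "a = lead_coeff p"
    have a: "a \<in> R" "a \<noteq> 0" using pR by (auto simp: a_def polys_over_def)
    define D where "D = {d \<in> polys_over R. poly d x \<noteq> 0 \<and> (\<exists>t\<in>polys_over R. poly d x = poly t x * v)}"
    have "w \<in> D" using w v subring_one[OF P] unfolding D_def
      by (auto intro!: bexI[of _ 1])
    then obtain d where d: "d \<in> D" and mind: "\<And>q. q \<in> D \<Longrightarrow> Polynomial.degree d \<le> Polynomial.degree q"
      using ex_has_least_nat[of "\<lambda>q. q \<in> D" w Polynomial.degree] by blast
    then obtain t where dt: "d \<in> polys_over R" "poly d x \<noteq> 0" "t \<in> polys_over R" "poly d x = poly t x * v"
      by (auto simp: D_def)
    have d0: "d \<noteq> 0" using dt by auto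
    have rem: "r \<in> D" if "poly r x = poly e x * poly d x" "poly r x \<noteq> 0" "r \<in> polys_over R" "e \<in> polys_over R" for r e
      using that dt subring_mult[OF P that(4) dt(3)] unfolding D_def
      by (auto intro!: bexI[of _ "e * t"] simp: mult.assoc)
    \<comment> \<open>The remainder of \<open>d\<close> modulo \<open>p\<close> has value \<open>a\<^sup>k d(x)\<close>, so it is again a candidate for \<open>d\<close>.\<close>
    have degd: "Polynomial.degree d < Polynomial.degree p"
    proof -
      obtain k s r where *: "s \<in> polys_over R" "r \<in> polys_over R" "Polynomial.smult (a ^ k) d = p * s + r"
        "r = 0 \<or> Polynomial.degree r < Polynomial.degree p"
        using pseudo_division_over[OF R pR(1,2) dt(1)] unfolding a_def by blast
      have "poly r x = poly [:a ^ k:] x * poly d x"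
        using arg_cong[OF *(3), of "\<lambda>q. poly q x"] pR by simp
      moreover from this have "poly r x \<noteq> 0" using a dt by simp
      moreover have "[:a ^ k:] \<in> polys_over R"
        using polys_over_pCons[OF R subring_power[OF R a(1)] subring_zero[OF P]] .
      ultimately have "r \<in> D" using rem *(2) by blast
      then have "Polynomial.degree d \<le> Polynomial.degree r" using mind by blast
      moreover have "r \<noteq> 0" using \<open>poly r x \<noteq> 0\<close> by auto
      ultimately show ?thesis using * by auto
    qed
    \<comment> \<open>Otherwise the remainder of \<open>p\<close> modulo \<open>d\<close> vanishes, so \<open>b\<^sup>k p = d s\<close> with \<open>b\<close> the leading
      coefficient of \<open>d\<close>, and \<open>s\<close> is a relation of smaller degree than \<open>p\<close>.\<close>
    have "Polynomial.degree d = 0"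
    proof (rule ccontr)
      assume dpos: "Polynomial.degree d \<noteq> 0"
      define b where "b = lead_coeff d"
      have b: "b \<noteq> 0" using d0 by (simp add: b_def)
      obtain k s r where *: "s \<in> polys_over R" "r \<in> polys_over R" "Polynomial.smult (b ^ k) p = d * s + r"
        "r = 0 \<or> Polynomial.degree r < Polynomial.degree d"
        using pseudo_division_over[OF R dt(1) d0 pR(1)] unfolding b_def by blast
      have rx: "poly r x = poly (- s) x * poly d x"
        using arg_cong[OF *(3), of "\<lambda>q. poly q x"] pR by (simp add: eq_neg_iff_add_eq_0 algebra_simps)
      have "poly r x = 0"
      proof (rule ccontr)
        assume "poly r x \<noteq> 0"
        then have "r \<in> D" "r \<noteq> 0" using rem[OF rx _ *(2) subring_uminus[OF P *(1)]] by auto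
        then show False using mind[of r] *(4) by simp
      qed
      then have r0: "r = 0" using small0[OF *(2)] *(4) degd by force
      have sx: "poly s x = 0" using rx \<open>poly r x = 0\<close> dt by simp
      have eq: "Polynomial.smult (b ^ k) p = d * s" using * r0 by simp
      then have "s \<noteq> 0" using b pR by auto
      then have "Polynomial.degree p = Polynomial.degree d + Polynomial.degree s"
        using arg_cong[OF eq, of Polynomial.degree] b d0 by (simp add: degree_mult_eq)
      then have "s = 0" using small0[OF *(1) sx] dpos by simp
      with \<open>s \<noteq> 0\<close> show False by simp
    qed
    then obtain c where c: "d = [:c:]" by (meson degree_eq_zeroE)
    have cR: "c \<in> R" "c \<noteq> 0" using dt(1) d0 c by (auto simp: polys_over_def dest: spec[of _ 0])
    show ?thesis
    proof (intro bexI[of _ "a * c"] conjI allI impI)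
      show "a * c \<in> R" using subring_mult[OF R a(1) cR(1)] .
      show "a * c \<noteq> 0" using a cR by simp
      fix f assume f: "subring_hom R S f" and fu: "f (a * c) \<noteq> 0"
      note F = subring_homD[OF map_poly_subring_hom[OF f]]
      have fa: "f a \<noteq> 0" "f c \<noteq> 0" using fu subring_homD(6)[OF f a(1) cR(1)] by auto
      have "Polynomial.coeff (map_poly f p) (Polynomial.degree p) \<noteq> 0"
        using fa subring_homD(2)[OF f] by (simp add: coeff_map_poly a_def)
      then have "Polynomial.degree (map_poly f p) > 0" using degp le_degree by fastforce
      then obtain \<xi> where \<xi>: "\<xi> \<in> S" "poly (map_poly f p) \<xi> = 0"
        using S F(4)[OF pR(1)] by (auto simp: root_closed_subring_def)
      have fpow: "f (a ^ k) \<noteq> 0" for k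
      proof (induction k)
        case (Suc k)
        then show ?case using fa subring_homD(6)[OF f a(1) subring_power[OF R a(1)], of k] by simp
      qed (simp add: subring_homD(3)[OF f])
      have "poly (map_poly f q) \<xi> = 0" if q: "q \<in> polys_over R" "poly q x = 0" for q
      proof -
        obtain k s r where *: "s \<in> polys_over R" "r \<in> polys_over R" "Polynomial.smult (a ^ k) q = p * s + r"
          "r = 0 \<or> Polynomial.degree r < Polynomial.degree p"
          using pseudo_division_over[OF R pR(1,2) q(1)] unfolding a_def by blast
        have "poly r x = 0" using arg_cong[OF *(3), of "\<lambda>q. poly q x"] pR q by simp
        then have "r = 0" using small0[OF *(2)] *(4) by blast
        then have "Polynomial.smult (f (a ^ k)) (map_poly f q) = map_poly f p * map_poly f s"
          using map_poly_smult_subring_hom[OF f subring_power[OF R a(1)] q(1), of k] *(3) F(6)[OF pR(1) *(1)] by simp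
        then have "f (a ^ k) * poly (map_poly f q) \<xi> = 0"
          using \<xi>(2) by (metis mult_zero_left poly_mult poly_smult)
        then show ?thesis using fpow by simp
      qed
      from subring_hom_extend_adjoin[OF f S' \<xi>(1) this] obtain g where
        g: "subring_hom (adjoin R x) S g" "\<forall>r\<in>R. g r = f r" by metis
      have "g (poly t x * v) = g (poly t x) * g v"
        using v dt by (intro subring_homD(6)[OF g(1)]) (auto simp: adjoin_def)
      moreover have "poly t x * v = c" using dt c by simp
      ultimately have "g v \<noteq> 0" using g(2) cR fa by auto
      then show "\<exists>g. subring_hom (adjoin R x) S g \<and> (\<forall>r\<in>R. g r = f r) \<and> g v \<noteq> 0" using g by blast
    qed
  qed
qed

text \<open>
  The elements of \<open>Z\<close> are adjoined one at a time, but \<open>u\<close> is found in the opposite direction: the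
  element to be kept nonzero in the larger ring yields one in the smaller ring.
\<close>

lemma finite_adjoin_hom_extension:
  fixes R :: "'a::idom set" and S :: "'b::idom set"
  assumes R: "is_subring R" and S: "root_closed_subring S" and "finite Z"
  shows "\<exists>T. is_subring T \<and> R \<union> Z \<subseteq> T \<and>
    (\<forall>v\<in>T. v \<noteq> 0 \<longrightarrow> (\<exists>u\<in>R. u \<noteq> 0 \<and> (\<forall>f. subring_hom R S f \<longrightarrow> f u \<noteq> 0 \<longrightarrow>
      (\<exists>g. subring_hom T S g \<and> (\<forall>r\<in>R. g r = f r) \<and> g v \<noteq> 0))))"
  using \<open>finite Z\<close>
proof (induction Z)
  case empty
  show ?case using R by (intro exI[of _ R]) blast
next
  case (insert x Z)
  then obtain T where T: "is_subring T" "R \<union> Z \<subseteq> T"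
    and ext: "\<And>v. v\<in>T \<Longrightarrow> v \<noteq> 0 \<Longrightarrow> \<exists>u\<in>R. u \<noteq> 0 \<and> (\<forall>f. subring_hom R S f \<longrightarrow> f u \<noteq> 0 \<longrightarrow>
      (\<exists>g. subring_hom T S g \<and> (\<forall>r\<in>R. g r = f r) \<and> g v \<noteq> 0))" by blast
  show ?case
  proof (intro exI[of _ "adjoin T x"] conjI ballI impI)
    show "is_subring (adjoin T x)" by (rule is_subring_adjoin[OF T(1)])
    show "R \<union> insert x Z \<subseteq> adjoin T x" using adjoin_base[OF T(1)] adjoin_gen[OF T(1)] T(2) by blast
    fix v assume "v \<in> adjoin T x" "v \<noteq> 0"
    from adjoin_hom_extension[OF T(1) S this] obtain u where u: "u \<in> T" "u \<noteq> 0"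
      and ext': "\<And>f. subring_hom T S f \<Longrightarrow> f u \<noteq> 0 \<Longrightarrow>
        \<exists>g. subring_hom (adjoin T x) S g \<and> (\<forall>r\<in>T. g r = f r) \<and> g v \<noteq> 0" by blast
    from ext[OF u] obtain u' where u': "u' \<in> R" "u' \<noteq> 0"
      and ext2: "\<And>f. subring_hom R S f \<Longrightarrow> f u' \<noteq> 0 \<Longrightarrow>
        \<exists>g. subring_hom T S g \<and> (\<forall>r\<in>R. g r = f r) \<and> g u \<noteq> 0" by blast
    have "\<exists>g. subring_hom (adjoin T x) S g \<and> (\<forall>r\<in>R. g r = f r) \<and> g v \<noteq> 0"
      if f: "subring_hom R S f" "f u' \<noteq> 0" for f
      using ext2[OF f] ext' T(2) by (metis Un_subset_iff subsetD)
    then show "\<exists>u\<in>R. u \<noteq> 0 \<and> (\<forall>f. subring_hom R S f \<longrightarrow> f u \<noteq> 0 \<longrightarrow>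
        (\<exists>g. subring_hom (adjoin T x) S g \<and> (\<forall>r\<in>R. g r = f r) \<and> g v \<noteq> 0))" using u' by blast
  qed
qed

text \<open>
  A homomorphism kills no nonzero element of a field, so the condition on \<open>u\<close> disappears.
\<close>

lemma subfield_hom_extension:
  fixes R :: "'a::field set" and S :: "'b::idom set"
  assumes f: "subring_hom R S f" and inv: "\<And>r. r \<in> R \<Longrightarrow> inverse r \<in> R"
    and S: "root_closed_subring S" and Z: "finite Z"
  shows "\<exists>T g. R \<union> Z \<subseteq> T \<and> subring_hom T S g \<and> (\<forall>r\<in>R. g r = f r)"
proof -
  from finite_adjoin_hom_extension[OF subring_homD(1)[OF f] S Z]
  obtain T where T: "is_subring T" "R \<union> Z \<subseteq> T"
    and ext: "\<And>v. v\<in>T \<Longrightarrow> v \<noteq> 0 \<Longrightarrow> \<exists>u\<in>R. u \<noteq> 0 \<and> (\<forall>f. subring_hom R S f \<longrightarrow> f u \<noteq> 0 \<longrightarrow>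
      (\<exists>g. subring_hom T S g \<and> (\<forall>r\<in>R. g r = f r) \<and> g v \<noteq> 0))" by blast
  from ext[OF subring_one[OF T(1)] one_neq_zero] obtain u where u: "u \<in> R" "u \<noteq> 0"
    and e: "\<And>f. subring_hom R S f \<Longrightarrow> f u \<noteq> 0 \<Longrightarrow> \<exists>g. subring_hom T S g \<and> (\<forall>r\<in>R. g r = f r)" by blast
  have "f u * f (inverse u) = 1"
    using subring_homD(6)[OF f u(1) inv[OF u(1)]] u(2) subring_homD(3)[OF f] by simp
  then have "f u \<noteq> 0" by auto
  then show ?thesis using e[OF f] T(2) by blast
qed

section \<open>Algebraic closures as root-closed subrings\<close>

lemma root_closed_subring_inverse:
  fixes S :: "'a::field set"
  assumes S: "root_closed_subring S" and x: "x \<in> S"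
  shows "inverse x \<in> S"
proof (cases "x = 0")
  case False
  have sub: "is_subring S" using S by (simp add: root_closed_subring_def)
  have "[:- 1, x:] \<in> polys_over S"
    using polys_over_pCons[OF sub] subring_uminus[OF sub subring_one[OF sub]] x
      subring_zero[OF is_subring_polys_over[OF sub]] by simp
  moreover have "Polynomial.degree [:- 1, x:] > 0" using False by simp
  ultimately obtain y where "y \<in> S" "poly [:- 1, x:] y = 0"
    using S unfolding root_closed_subring_def by blast
  then have "x * y = 1" by (simp add: mult.commute)
  then show ?thesis using \<open>y \<in> S\<close> by (metis inverse_unique)
qed (use x in simp)

text \<open>
  Polynomials of the algebraic closure locale are coefficient lists with the leading coefficient first,
  which explains the reversal of the coefficient list below.
\<close>

lemma algebraic_closure_root_closed:
  fixes Q :: "'f::field set"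
  assumes "algebraic_closure (class_ring\<lparr>carrier := Q\<rparr>) K"
  shows "root_closed_subring Q"
proof -
  define L where "L = (class_ring\<lparr>carrier := Q\<rparr> :: 'f ring)"
  have [simp]: "carrier L = Q" "monoid.mult L = (*)" "one L = 1" "zero L = 0" "add L = (+)"
    by (simp_all add: L_def)
  interpret L: algebraic_closure L K using assms by (simp only: L_def)
  have neg: "- x \<in> Q" if "x \<in> Q" for x
  proof -
    have "(\<ominus>\<^bsub>L\<^esub> x) \<in> Q" "x + (\<ominus>\<^bsub>L\<^esub> x) = 0"
      using that L.a_inv_closed[of x] L.r_neg[of x] by simp_all
    then show ?thesis by (metis add_eq_0_iff)
  qed
  have sub: "is_subring Q"
    unfolding is_subring_def
  proof (intro conjI ballI)
    show "1 \<in> Q" using monoid.one_closed[OF L.monoid_axioms] by simp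
    fix x y assume "x \<in> Q" "y \<in> Q"
    then show "x - y \<in> Q" "x * y \<in> Q"
      using L.a_closed[of x "- y"] monoid.m_closed[OF L.monoid_axioms, of x y] neg by simp_all
  qed
  have pow: "x [^]\<^bsub>L\<^esub> n = x ^ n" for x and n :: nat
    by (induction n) simp_all
  have eval: "L.eval xs x = poly (Poly (rev xs)) x" for xs x
    by (induction xs) (simp_all add: pow Poly_append poly_monom)
  have "\<exists>x\<in>Q. poly p x = 0" if p: "p \<in> polys_over Q" "Polynomial.degree p > 0" for p
  proof -
    let ?P = "rev (coeffs p)"
    have deg: "Polynomials.degree ?P = Polynomial.degree p"
      by (simp add: degree_eq_length_coeffs)
    have nz: "p \<noteq> 0" using p by auto
    have "set (coeffs p) \<subseteq> Q"
      using p by (auto simp: coeffs_def polys_over_def)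
    then have P: "?P \<in> carrier (poly_ring L)"
      using nz by (simp add: univ_poly_def polynomial_def hd_rev last_coeffs_eq_coeff_degree)
    then have "L.splitted ?P" by (rule L.roots_over_carrier)
    then have "L.roots ?P \<noteq> {#}" using deg p(2) unfolding L.splitted_def by auto
    then obtain x where "x \<in># L.roots ?P" by blast
    then have "L.is_root ?P x" using L.roots_mem_iff_is_root[OF P] by auto
    then have "x \<in> Q" "L.eval ?P x = 0" by (simp_all add: L.is_root_def)
    then show ?thesis unfolding eval by auto
  qed
  then show ?thesis using sub by (simp add: root_closed_subring_def)
qed

section \<open>Coordinate algebras and isomorphism matrices\<close>

lemma algebra_isomorphic_trans:
  assumes "algebra_isomorphic K A B" "algebra_isomorphic K B C"
  shows "algebra_isomorphic K A C"
proof -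
  obtain h k where h: "h \<in> module_hom K A B" "bij_betw h (carrier A) (carrier B)"
      "\<forall>x\<in>carrier A. \<forall>y\<in>carrier A. h (x \<otimes>\<^bsub>A\<^esub> y) = h x \<otimes>\<^bsub>B\<^esub> h y"
    and k: "k \<in> module_hom K B C" "bij_betw k (carrier B) (carrier C)"
      "\<forall>x\<in>carrier B. \<forall>y\<in>carrier B. k (x \<otimes>\<^bsub>B\<^esub> y) = k x \<otimes>\<^bsub>C\<^esub> k y"
    using assms by (auto simp: algebra_isomorphic_def)
  have hB: "h x \<in> carrier B" if "x \<in> carrier A" for x using h(1) that by (auto simp: module_hom_def)
  have "k \<circ> h \<in> module_hom K A C" using h(1) k(1) hB by (auto simp: module_hom_def)
  moreover have "bij_betw (k \<circ> h) (carrier A) (carrier C)" using h(2) k(2) by (rule bij_betw_trans)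
  ultimately show ?thesis
    unfolding algebra_isomorphic_def using h(3) k(3) hB by (intro bexI[of _ "k \<circ> h"]) auto
qed

text \<open>
  As \<open>A\<close> may be any structure with these operations, its carrier has to be closed under them: \<open>inv_into\<close>
  undoes \<open>h\<close> on the carrier only.
\<close>

lemma inverse_algebra_iso:
  assumes h: "h \<in> module_hom K A B" "bij_betw h (carrier A) (carrier B)"
      "\<forall>x\<in>carrier A. \<forall>y\<in>carrier A. h (x \<otimes>\<^bsub>A\<^esub> y) = h x \<otimes>\<^bsub>B\<^esub> h y"
    and closed: "\<And>x y. x \<in> carrier A \<Longrightarrow> y \<in> carrier A \<Longrightarrow> x \<oplus>\<^bsub>A\<^esub> y \<in> carrier A"
      "\<And>x y. x \<in> carrier A \<Longrightarrow> y \<in> carrier A \<Longrightarrow> x \<otimes>\<^bsub>A\<^esub> y \<in> carrier A"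
      "\<And>c x. c \<in> carrier K \<Longrightarrow> x \<in> carrier A \<Longrightarrow> c \<odot>\<^bsub>A\<^esub> x \<in> carrier A"
  defines "g \<equiv> inv_into (carrier A) h"
  shows "g \<in> module_hom K B A" "bij_betw g (carrier B) (carrier A)"
    "\<forall>x\<in>carrier B. \<forall>y\<in>carrier B. g (x \<otimes>\<^bsub>B\<^esub> y) = g x \<otimes>\<^bsub>A\<^esub> g y"
proof -
  show bij: "bij_betw g (carrier B) (carrier A)" unfolding g_def by (rule bij_betw_inv_into[OF h(2)])
  have gh: "g (h x) = x" if "x \<in> carrier A" for x
    unfolding g_def using bij_betw_inv_into_left[OF h(2) that] .
  have hg: "\<exists>a\<in>carrier A. y = h a" if "y \<in> carrier B" for y
    using h(2) that by (auto simp: bij_betw_def)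
  have add: "g (h a \<oplus>\<^bsub>B\<^esub> h b) = a \<oplus>\<^bsub>A\<^esub> b" if "a \<in> carrier A" "b \<in> carrier A" for a b
    using gh[OF closed(1)[OF that]] module_hom_add[OF h(1) that] by simp
  have sm: "g (c \<odot>\<^bsub>B\<^esub> h a) = c \<odot>\<^bsub>A\<^esub> a" if "c \<in> carrier K" "a \<in> carrier A" for a c
    using gh[OF closed(3)[OF that]] module_hom_smult[OF h(1) that] by simp
  have mu: "g (h a \<otimes>\<^bsub>B\<^esub> h b) = a \<otimes>\<^bsub>A\<^esub> b" if "a \<in> carrier A" "b \<in> carrier A" for a b
    using gh[OF closed(2)[OF that]] h(3) that by simp
  show "g \<in> module_hom K B A"
    unfolding module_hom_def using bij_betw_apply[OF bij] add sm gh by (auto dest!: hg)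
  show "\<forall>x\<in>carrier B. \<forall>y\<in>carrier B. g (x \<otimes>\<^bsub>B\<^esub> y) = g x \<otimes>\<^bsub>A\<^esub> g y"
    using mu gh by (auto dest!: hg)
qed

text \<open>
  Vectors are functions vanishing off \<open>E\<close>, rather than extensional ones, so that the linear structure
  is the pointwise one.
\<close>

definition coordinate_algebra :: "'i set \<Rightarrow> ('i \<Rightarrow> 'i \<Rightarrow> 'i \<Rightarrow> 'f::field) \<Rightarrow> ('f, 'i \<Rightarrow> 'f) module" where
  "coordinate_algebra E \<gamma> =
     \<lparr>carrier = {v. \<forall>i. i \<notin> E \<longrightarrow> v i = 0},
      monoid.mult = (\<lambda>v w k. if k \<in> E then \<Sum>i\<in>E. \<Sum>j\<in>E. v i * w j * \<gamma> i j k else 0),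
      one = undefined,
      zero = (\<lambda>_. 0),
      add = (\<lambda>v w i. v i + w i),
      smult = (\<lambda>c v i. c * v i)\<rparr>"

lemma coordinate_algebra_simps [simp]:
  "v \<in> carrier (coordinate_algebra E \<gamma>) \<longleftrightarrow> (\<forall>i. i \<notin> E \<longrightarrow> v i = 0)"
  "v \<otimes>\<^bsub>coordinate_algebra E \<gamma>\<^esub> w = (\<lambda>k. if k \<in> E then \<Sum>i\<in>E. \<Sum>j\<in>E. v i * w j * \<gamma> i j k else 0)"
  "v \<oplus>\<^bsub>coordinate_algebra E \<gamma>\<^esub> w = (\<lambda>i. v i + w i)"
  "c \<odot>\<^bsub>coordinate_algebra E \<gamma>\<^esub> v = (\<lambda>i. c * v i)"
  by (simp_all add: coordinate_algebra_def)

lemma algebra_isomorphic_from_coordinates_sym: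
  assumes "algebra_isomorphic class_ring (coordinate_algebra E \<gamma>) B"
  shows "algebra_isomorphic class_ring B (coordinate_algebra E \<gamma>)"
proof -
  obtain h where h: "h \<in> module_hom class_ring (coordinate_algebra E \<gamma>) B"
    "bij_betw h (carrier (coordinate_algebra E \<gamma>)) (carrier B)"
    "\<forall>x\<in>carrier (coordinate_algebra E \<gamma>). \<forall>y\<in>carrier (coordinate_algebra E \<gamma>).
       h (x \<otimes>\<^bsub>coordinate_algebra E \<gamma>\<^esub> y) = h x \<otimes>\<^bsub>B\<^esub> h y"
    using assms unfolding algebra_isomorphic_def by blast
  note inv = inverse_algebra_iso[OF h]
  show ?thesis
    unfolding algebra_isomorphic_def
    by (intro bexI[OF _ inv(1)] conjI inv(2,3)) simp_all
qed

text \<open>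
  \<open>P\<close> and \<open>Q\<close> are the matrices of an isomorphism and its inverse. Invertibility is expressed through \<open>Q\<close>
  and not through a determinant so that all conditions are polynomial equations, which ring
  homomorphisms preserve; the last one says that \<open>P\<close> respects products of basis vectors.
\<close>

definition isomorphism_matrices ::
    "'i set \<Rightarrow> 'j set \<Rightarrow> ('i \<Rightarrow> 'i \<Rightarrow> 'i \<Rightarrow> 'f) \<Rightarrow> ('j \<Rightarrow> 'j \<Rightarrow> 'j \<Rightarrow> 'f) \<Rightarrow>
     ('i \<Rightarrow> 'j \<Rightarrow> 'f::field) \<Rightarrow> ('j \<Rightarrow> 'i \<Rightarrow> 'f) \<Rightarrow> bool" where
  "isomorphism_matrices I J \<gamma> \<delta> P Q \<longleftrightarrow>
     (\<forall>i\<in>I. \<forall>i'\<in>I. (\<Sum>j\<in>J. P i j * Q j i') = (if i = i' then 1 else 0)) \<and>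
     (\<forall>j\<in>J. \<forall>j'\<in>J. (\<Sum>i\<in>I. Q j i * P i j') = (if j = j' then 1 else 0)) \<and>
     (\<forall>i\<in>I. \<forall>i'\<in>I. \<forall>k\<in>J.
        (\<Sum>l\<in>I. \<gamma> i i' l * P l k) = (\<Sum>j\<in>J. \<Sum>j'\<in>J. P i j * P i' j' * \<delta> j j' k))"

abbreviation unit_vector :: "'i \<Rightarrow> 'i \<Rightarrow> 'f::zero_neq_one" where
  "unit_vector i \<equiv> (\<lambda>j. if i = j then 1 else 0)"

lemma coordinate_algebra_hom_expand:
  assumes fin: "finite I" and h: "h \<in> module_hom class_ring (coordinate_algebra I \<gamma>) (coordinate_algebra J \<delta>)"
    and v: "\<forall>i. i \<notin> I \<longrightarrow> v i = 0"
  shows "h v j = (\<Sum>i\<in>I. v i * h (unit_vector i) j)"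
proof -
  have z: "h (\<lambda>_. 0) = (\<lambda>_. 0)"
    using module_hom_smult[OF h, of 0 "\<lambda>_. 0"] by simp
  have "h (\<lambda>k. if k \<in> F then v k else 0) j = (\<Sum>i\<in>F. v i * h (unit_vector i) j)" if "F \<subseteq> I" for F
    using finite_subset[OF that fin] that
  proof (induction F)
    case empty
    show ?case by (simp add: z)
  next
    case (insert i F)
    have eq: "(\<lambda>k. if k \<in> insert i F then v k else 0) =
        (\<lambda>k. (\<lambda>k. v i * unit_vector i k) k + (\<lambda>k. if k \<in> F then v k else 0) k)"
      using insert(2) by auto
    have "h (\<lambda>k. v i * unit_vector i k) = (\<lambda>k. v i * h (unit_vector i) k)"
      using module_hom_smult[OF h, of "v i" "unit_vector i"] insert(4) by simp
    moreover have "h (\<lambda>k. (\<lambda>k. v i * unit_vector i k) k + (\<lambda>k. if k \<in> F then v k else 0) k)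
        = (\<lambda>k. h (\<lambda>k. v i * unit_vector i k) k + h (\<lambda>k. if k \<in> F then v k else 0) k)"
      using module_hom_add[OF h, of "\<lambda>k. v i * unit_vector i k" "\<lambda>k. if k \<in> F then v k else 0"] insert(4)
      by (simp add: subset_iff)
    ultimately show ?case unfolding eq using insert by simp
  qed
  from this[of I] have "h (\<lambda>k. if k \<in> I then v k else 0) j = (\<Sum>i\<in>I. v i * h (unit_vector i) j)" by simp
  moreover have "(\<lambda>k. if k \<in> I then v k else 0) = v" using v by auto
  ultimately show ?thesis by simp
qed

lemma sum_unit_vector [simp]:
  fixes f :: "'i \<Rightarrow> 'f::field"
  assumes "finite I"
  shows "(\<Sum>i\<in>I. unit_vector k i * f i) = (if k \<in> I then f k else 0)"
    "(\<Sum>i\<in>I. f i * unit_vector k i) = (if k \<in> I then f k else 0)"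
  using assms by (simp_all add: if_distrib[of "\<lambda>x. x * _"] if_distrib[of "\<lambda>x. _ * x"] cong: if_cong)

lemma coordinate_algebra_iso_imp_matrices:
  assumes I: "finite I" and J: "finite J"
    and "algebra_isomorphic class_ring (coordinate_algebra I \<gamma>) (coordinate_algebra J \<delta>)"
  shows "\<exists>P Q. isomorphism_matrices I J \<gamma> \<delta> P Q"
proof -
  let ?A = "coordinate_algebra I \<gamma>" and ?B = "coordinate_algebra J \<delta>"
  obtain h where h: "h \<in> module_hom class_ring ?A ?B" and bij: "bij_betw h (carrier ?A) (carrier ?B)"
    and mu: "\<forall>x\<in>carrier ?A. \<forall>y\<in>carrier ?A. h (x \<otimes>\<^bsub>?A\<^esub> y) = h x \<otimes>\<^bsub>?B\<^esub> h y"
    using assms(3) unfolding algebra_isomorphic_def by blast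
  define g where "g = inv_into (carrier ?A) h"
  have g: "g \<in> module_hom class_ring ?B ?A"
    unfolding g_def by (rule inverse_algebra_iso(1)[OF h bij mu]) auto
  have gh: "g (h v) = v" if "v \<in> carrier ?A" for v
    unfolding g_def using bij_betw_inv_into_left[OF bij that] .
  have hg: "h (g v) = v" if "v \<in> carrier ?B" for v
    unfolding g_def using bij_betw_inv_into_right[OF bij that] .
  have hc: "h v \<in> carrier ?B" if "v \<in> carrier ?A" for v using bij_betw_apply[OF bij that] .
  have gc: "g v \<in> carrier ?A" if "v \<in> carrier ?B" for v using funcset_mem[OF module_hom_closed[OF g] that] .
  have uA: "unit_vector i \<in> carrier ?A" if "i \<in> I" for i using that by auto
  have uB: "unit_vector j \<in> carrier ?B" if "j \<in> J" for j using that by auto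
  have "isomorphism_matrices I J \<gamma> \<delta> (\<lambda>i. h (unit_vector i)) (\<lambda>j. g (unit_vector j))"
    unfolding isomorphism_matrices_def
  proof (intro conjI ballI)
    fix i i' assume i: "i \<in> I" "i' \<in> I"
    have "g (h (unit_vector i)) i' = (\<Sum>j\<in>J. h (unit_vector i) j * g (unit_vector j) i')"
      using hc[OF uA[OF i(1)]] by (intro coordinate_algebra_hom_expand[OF J g]) simp
    then show "(\<Sum>j\<in>J. h (unit_vector i) j * g (unit_vector j) i') = (if i = i' then 1 else 0)"
      using gh[OF uA[OF i(1)]] by simp
  next
    fix j j' assume j: "j \<in> J" "j' \<in> J"
    have "h (g (unit_vector j)) j' = (\<Sum>i\<in>I. g (unit_vector j) i * h (unit_vector i) j')"
      using gc[OF uB[OF j(1)]] by (intro coordinate_algebra_hom_expand[OF I h]) simp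
    then show "(\<Sum>i\<in>I. g (unit_vector j) i * h (unit_vector i) j') = (if j = j' then 1 else 0)"
      using hg[OF uB[OF j(1)]] by simp
  next
    fix i i' k assume i: "i \<in> I" "i' \<in> I" and k: "k \<in> J"
    define w where "w = (\<lambda>l. if l \<in> I then \<gamma> i i' l else 0)"
    have "unit_vector i \<otimes>\<^bsub>?A\<^esub> unit_vector i' = w"
      using i I by (auto simp: w_def fun_eq_iff mult.assoc sum_distrib_left[symmetric])
    then have "h w = h (unit_vector i) \<otimes>\<^bsub>?B\<^esub> h (unit_vector i')"
      using mu uA[OF i(1)] uA[OF i(2)] by metis
    then have "h w k = (\<Sum>j\<in>J. \<Sum>j'\<in>J. h (unit_vector i) j * h (unit_vector i') j' * \<delta> j j' k)"
      using k by simp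
    moreover have "h w k = (\<Sum>l\<in>I. w l * h (unit_vector l) k)"
      by (intro coordinate_algebra_hom_expand[OF I h]) (simp add: w_def)
    ultimately show "(\<Sum>l\<in>I. \<gamma> i i' l * h (unit_vector l) k) =
        (\<Sum>j\<in>J. \<Sum>j'\<in>J. h (unit_vector i) j * h (unit_vector i') j' * \<delta> j j' k)"
      by (simp add: w_def)
  qed
  then show ?thesis by blast
qed

lemma matrices_imp_coordinate_algebra_iso:
  assumes I: "finite I" and J: "finite J" and PQ: "isomorphism_matrices I J \<gamma> \<delta> P Q"
  shows "algebra_isomorphic class_ring (coordinate_algebra I \<gamma>) (coordinate_algebra J \<delta>)"
proof -
  let ?A = "coordinate_algebra I \<gamma>" and ?B = "coordinate_algebra J \<delta>"
  define h where "h v = (\<lambda>j. if j \<in> J then \<Sum>i\<in>I. v i * P i j else 0)" for v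
  define g where "g v = (\<lambda>i. if i \<in> I then \<Sum>j\<in>J. v j * Q j i else 0)" for v
  have gh: "g (h v) = v" if "v \<in> carrier ?A" for v
  proof
    fix i'
    show "g (h v) i' = v i'"
    proof (cases "i' \<in> I")
      case True
      have "(\<Sum>j\<in>J. h v j * Q j i') = (\<Sum>j\<in>J. \<Sum>i\<in>I. v i * (P i j * Q j i'))"
        by (simp add: h_def sum_distrib_right mult.assoc)
      also have "\<dots> = (\<Sum>i\<in>I. v i * (\<Sum>j\<in>J. P i j * Q j i'))"
        by (subst sum.swap) (simp add: sum_distrib_left)
      also have "\<dots> = (\<Sum>i\<in>I. v i * unit_vector i' i)"
        using PQ True by (intro sum.cong) (auto simp: isomorphism_matrices_def)
      finally show ?thesis using True I by (simp add: g_def)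
    qed (use that in \<open>simp add: g_def\<close>)
  qed
  have hg: "h (g v) = v" if "v \<in> carrier ?B" for v
  proof
    fix j'
    show "h (g v) j' = v j'"
    proof (cases "j' \<in> J")
      case True
      have "(\<Sum>i\<in>I. g v i * P i j') = (\<Sum>i\<in>I. \<Sum>j\<in>J. v j * (Q j i * P i j'))"
        by (simp add: g_def sum_distrib_right mult.assoc)
      also have "\<dots> = (\<Sum>j\<in>J. v j * (\<Sum>i\<in>I. Q j i * P i j'))"
        by (subst sum.swap) (simp add: sum_distrib_left)
      also have "\<dots> = (\<Sum>j\<in>J. v j * unit_vector j' j)"
        using PQ True by (intro sum.cong) (auto simp: isomorphism_matrices_def)
      finally show ?thesis using True J by (simp add: h_def)
    qed (use that in \<open>simp add: h_def\<close>)
  qed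
  have "bij_betw h (carrier ?A) (carrier ?B)"
    by (rule bij_betw_byWitness[of _ g]) (use gh hg in \<open>auto simp: h_def g_def\<close>)
  moreover have "h \<in> module_hom class_ring ?A ?B"
    unfolding module_hom_def
    by (auto simp: h_def fun_eq_iff sum.distrib distrib_right sum_distrib_left mult.assoc)
  moreover have "h (v \<otimes>\<^bsub>?A\<^esub> w) = h v \<otimes>\<^bsub>?B\<^esub> h w" for v w
  proof
    fix k
    show "h (v \<otimes>\<^bsub>?A\<^esub> w) k = (h v \<otimes>\<^bsub>?B\<^esub> h w) k"
    proof (cases "k \<in> J")
      case True
      have "h (v \<otimes>\<^bsub>?A\<^esub> w) k = (\<Sum>l\<in>I. \<Sum>i\<in>I. \<Sum>i'\<in>I. v i * w i' * (\<gamma> i i' l * P l k))"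
        using True by (simp add: h_def sum_distrib_right mult.assoc)
      also have "\<dots> = (\<Sum>i\<in>I. \<Sum>l\<in>I. \<Sum>i'\<in>I. v i * w i' * (\<gamma> i i' l * P l k))"
        by (rule sum.swap)
      also have "\<dots> = (\<Sum>i\<in>I. \<Sum>i'\<in>I. v i * w i' * (\<Sum>l\<in>I. \<gamma> i i' l * P l k))"
        by (rule sum.cong[OF refl], subst sum.swap) (simp add: sum_distrib_left)
      also have "\<dots> = (\<Sum>i\<in>I. \<Sum>i'\<in>I. v i * w i' * (\<Sum>j\<in>J. \<Sum>j'\<in>J. P i j * P i' j' * \<delta> j j' k))"
        using PQ True by (intro sum.cong refl) (auto simp: isomorphism_matrices_def)
      also have "\<dots> = (\<Sum>i\<in>I. \<Sum>i'\<in>I. \<Sum>j\<in>J. \<Sum>j'\<in>J. v i * P i j * (w i' * P i' j') * \<delta> j j' k)"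
        by (simp add: sum_distrib_left algebra_simps)
      also have "\<dots> = (\<Sum>i\<in>I. \<Sum>j\<in>J. \<Sum>i'\<in>I. \<Sum>j'\<in>J. v i * P i j * (w i' * P i' j') * \<delta> j j' k)"
        by ((rule sum.cong[OF refl])+, rule sum.swap)
      also have "\<dots> = (\<Sum>j\<in>J. \<Sum>i\<in>I. \<Sum>i'\<in>I. \<Sum>j'\<in>J. v i * P i j * (w i' * P i' j') * \<delta> j j' k)"
        by (rule sum.swap)
      also have "\<dots> = (\<Sum>j\<in>J. \<Sum>i\<in>I. \<Sum>j'\<in>J. \<Sum>i'\<in>I. v i * P i j * (w i' * P i' j') * \<delta> j j' k)"
        by ((rule sum.cong[OF refl])+, rule sum.swap)
      also have "\<dots> = (\<Sum>j\<in>J. \<Sum>j'\<in>J. \<Sum>i\<in>I. \<Sum>i'\<in>I. v i * P i j * (w i' * P i' j') * \<delta> j j' k)"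
        by ((rule sum.cong[OF refl])+, rule sum.swap)
      also have "\<dots> = (\<Sum>j\<in>J. \<Sum>j'\<in>J. h v j * h w j' * \<delta> j j' k)"
        by (intro sum.cong refl) (simp only: h_def if_True sum_product, simp only: sum_distrib_right)
      finally show ?thesis using True by simp
    qed (simp add: h_def)
  qed
  ultimately show ?thesis unfolding algebra_isomorphic_def by blast
qed

text \<open>
  Each condition equates two expressions built by sums and products from elements of \<open>T\<close>, so \<open>g\<close> may be
  applied to it.
\<close>

lemma isomorphism_matrices_hom:
  assumes g: "subring_hom T S g" and PQ: "isomorphism_matrices I J \<gamma> \<delta> P Q"
    and T: "\<And>i j. i \<in> I \<Longrightarrow> j \<in> J \<Longrightarrow> P i j \<in> T \<and> Q j i \<in> T"
      "\<And>i i' k. i \<in> I \<Longrightarrow> i' \<in> I \<Longrightarrow> k \<in> I \<Longrightarrow> \<gamma> i i' k \<in> T"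
      "\<And>j j' k. j \<in> J \<Longrightarrow> j' \<in> J \<Longrightarrow> k \<in> J \<Longrightarrow> \<delta> j j' k \<in> T"
  shows "isomorphism_matrices I J (\<lambda>i j k. g (\<gamma> i j k)) (\<lambda>i j k. g (\<delta> i j k))
    (\<lambda>i j. g (P i j)) (\<lambda>j i. g (Q j i))"
  unfolding isomorphism_matrices_def
proof (intro conjI ballI)
  note D = subring_homD[OF g]
  note m = subring_mult[OF D(1)] and s = subring_sum[OF D(1)] and gs = subring_hom_sum[OF g]
  {
    fix i i' assume i: "i \<in> I" "i' \<in> I"
    have "(\<Sum>j\<in>J. g (P i j) * g (Q j i')) = (\<Sum>j\<in>J. g (P i j * Q j i'))"
      using i T(1) by (intro sum.cong) (auto simp: D(6))
    also have "\<dots> = g (\<Sum>j\<in>J. P i j * Q j i')" using i T(1) by (subst gs) (auto intro: m)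
    also have "\<dots> = (if i = i' then 1 else 0)" using PQ i D(2,3) by (auto simp: isomorphism_matrices_def)
    finally show "(\<Sum>j\<in>J. g (P i j) * g (Q j i')) = (if i = i' then 1 else 0)" .
  }
  {
    fix i i' assume i: "i \<in> J" "i' \<in> J"
    have "(\<Sum>j\<in>I. g (Q i j) * g (P j i')) = (\<Sum>j\<in>I. g (Q i j * P j i'))"
      using i T(1) by (intro sum.cong) (auto simp: D(6))
    also have "\<dots> = g (\<Sum>j\<in>I. Q i j * P j i')" using i T(1) by (subst gs) (auto intro: m)
    also have "\<dots> = (if i = i' then 1 else 0)" using PQ i D(2,3) by (auto simp: isomorphism_matrices_def)
    finally show "(\<Sum>j\<in>I. g (Q i j) * g (P j i')) = (if i = i' then 1 else 0)" .
  }
  fix i i' k assume i: "i \<in> I" "i' \<in> I" and k: "k \<in> J"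
  have "(\<Sum>l\<in>I. g (\<gamma> i i' l) * g (P l k)) = (\<Sum>l\<in>I. g (\<gamma> i i' l * P l k))"
    using i k T by (intro sum.cong) (auto simp: D(6))
  also have "\<dots> = g (\<Sum>l\<in>I. \<gamma> i i' l * P l k)" using i k T by (subst gs) (auto intro: m)
  also have "\<dots> = g (\<Sum>j\<in>J. \<Sum>j'\<in>J. P i j * P i' j' * \<delta> j j' k)"
    using PQ i k by (simp add: isomorphism_matrices_def)
  also have "\<dots> = (\<Sum>j\<in>J. \<Sum>j'\<in>J. g (P i j * P i' j' * \<delta> j j' k))"
    using i k T by (subst gs, fastforce intro!: s m, intro sum.cong refl gs m) auto
  also have "\<dots> = (\<Sum>j\<in>J. \<Sum>j'\<in>J. g (P i j) * g (P i' j') * g (\<delta> j j' k))"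
    using i k T by (intro sum.cong refl) (simp add: D(6) m)
  finally show "(\<Sum>l\<in>I. g (\<gamma> i i' l) * g (P l k)) =
      (\<Sum>j\<in>J. \<Sum>j'\<in>J. g (P i j) * g (P i' j') * g (\<delta> j j' k))" .
qed

section \<open>Scalar extension as a coordinate algebra\<close>

text \<open>
  The analogue of \<^const>\<open>frag_extend\<close> for values in a ring: the additive map on formal sums that
  extends \<open>h\<close>.
\<close>

definition additive_extension :: "('p \<Rightarrow> 'f::ring_1) \<Rightarrow> ('p \<Rightarrow>\<^sub>0 int) \<Rightarrow> 'f" where
  "additive_extension h x = (\<Sum>p\<in>Poly_Mapping.keys x. of_int (Poly_Mapping.lookup x p) * h p)"

lemma additive_extension_superset:
  assumes "finite S" "Poly_Mapping.keys x \<subseteq> S"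
  shows "additive_extension h x = (\<Sum>p\<in>S. of_int (Poly_Mapping.lookup x p) * h p)"
  unfolding additive_extension_def using assms
  by (intro sum.mono_neutral_left) (auto simp: in_keys_iff)

lemma additive_extension_simps [simp]:
  shows additive_extension_0: "additive_extension h 0 = 0"
    and additive_extension_of: "additive_extension h (frag_of p) = h p"
    and additive_extension_add: "additive_extension h (x + y) = additive_extension h x + additive_extension h y"
    and additive_extension_diff: "additive_extension h (x - y) = additive_extension h x - additive_extension h y"
proof -
  show "additive_extension h 0 = 0" "additive_extension h (frag_of p) = h p"
    by (simp_all add: additive_extension_def)
  let ?S = "Poly_Mapping.keys x \<union> Poly_Mapping.keys y"
  have *: "additive_extension h z = (\<Sum>p\<in>?S. of_int (Poly_Mapping.lookup z p) * h p)"
    if "Poly_Mapping.keys z \<subseteq> ?S" for z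
    using that by (intro additive_extension_superset) auto
  show "additive_extension h (x + y) = additive_extension h x + additive_extension h y"
    using *[OF keys_add] *[of x] *[of y] by (simp add: lookup_add distrib_right sum.distrib)
  show "additive_extension h (x - y) = additive_extension h x - additive_extension h y"
    using *[OF keys_diff] *[of x] *[of y] by (simp add: lookup_minus left_diff_distrib sum_subtractf)
qed

lemma additive_extension_minus [simp]: "additive_extension h (- x) = - additive_extension h x"
  using additive_extension_diff[of h 0 x] by simp

lemma additive_extension_sum:
  "additive_extension h (sum f I) = (\<Sum>i\<in>I. additive_extension h (f i))"
  by (induction I rule: infinite_finite_induct) simp_all

text \<open>
  \<open>\<iota>\<close> is the embedding of fields along which the scalars of \<open>A\<close> are to be extended.
\<close>

locale based_algebra = nonassoc_algebra "class_ring :: 'k ring" A + field_hom \<iota>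
  for A :: "('k::field, 'a) module" (structure) and \<iota> :: "'k \<Rightarrow> 'f::field" +
  fixes E :: "'a set" and \<gamma> :: "'a \<Rightarrow> 'a \<Rightarrow> 'a \<Rightarrow> 'k"
  assumes fin_dim: "fin_dim" and basis: "basis E"
    and structure_constants: "structure_constants class_ring A E \<gamma>"
begin

lemma finite_E: "finite E" and E_carrier: "E \<subseteq> carrier A"
  using fin_dim_li_fin[OF fin_dim] basis by (auto simp: basis_def)

lemma lincomb_in_carrier: "H \<subseteq> E \<Longrightarrow> (\<Oplus>i\<in>H. c i \<odot> i) \<in> carrier A"
  using E_carrier by (intro finsum_closed) auto

lemma lincomb_unique:
  assumes "a \<in> carrier A"
  shows "\<exists>!c. (\<forall>i. i \<notin> E \<longrightarrow> c i = 0) \<and> a = (\<Oplus>i\<in>E. c i \<odot> i)"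
proof -
  have "\<exists>!d. d \<in> E \<rightarrow>\<^sub>E UNIV \<and> lincomb d E = a"
    using iffD1[OF basis_criterion[OF finite_E E_carrier] basis, rule_format, OF assms]
    by (simp only: partial_object.select_convs)
  then obtain d where d: "d \<in> E \<rightarrow>\<^sub>E UNIV \<and> lincomb d E = a"
    and uniq: "\<forall>d'. d' \<in> E \<rightarrow>\<^sub>E UNIV \<and> lincomb d' E = a \<longrightarrow> d' = d"
    by (rule ex1E)
  have cong: "(\<Oplus>i\<in>E. c i \<odot> i) = (\<Oplus>i\<in>E. c' i \<odot> i)" if "\<And>i. i \<in> E \<Longrightarrow> c i = c' i" for c c'
    using that E_carrier by (intro finsum_cong') auto
  show ?thesis
  proof (rule ex1I[of _ "\<lambda>i. if i \<in> E then d i else 0"])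
    show "(\<forall>i. i \<notin> E \<longrightarrow> (if i \<in> E then d i else 0) = 0) \<and> a = (\<Oplus>i\<in>E. (if i \<in> E then d i else 0) \<odot> i)"
      using d cong[of "\<lambda>i. if i \<in> E then d i else 0" d] by (simp add: lincomb_def)
    fix c assume c: "(\<forall>i. i \<notin> E \<longrightarrow> c i = 0) \<and> a = (\<Oplus>i\<in>E. c i \<odot> i)"
    have "d = restrict c E"
      using c cong[of "restrict c E" c] by (intro uniq[rule_format, symmetric]) (auto simp: lincomb_def)
    then show "c = (\<lambda>i. if i \<in> E then d i else 0)" using c by (auto simp: fun_eq_iff)
  qed
qed

definition coord :: "'a \<Rightarrow> 'a \<Rightarrow> 'k" where
  "coord a = (THE c. (\<forall>i. i \<notin> E \<longrightarrow> c i = 0) \<and> a = (\<Oplus>i\<in>E. c i \<odot> i))"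

lemma coord_outside: "a \<in> carrier A \<Longrightarrow> i \<notin> E \<Longrightarrow> coord a i = 0"
  and coord_expand: "a \<in> carrier A \<Longrightarrow> (\<Oplus>i\<in>E. coord a i \<odot> i) = a"
  unfolding coord_def using theI'[OF lincomb_unique[of a]] by auto

lemma coord_lincomb: "coord (\<Oplus>i\<in>E. c i \<odot> i) = (\<lambda>i. if i \<in> E then c i else 0)"
proof -
  have "(\<Oplus>i\<in>E. c i \<odot> i) = (\<Oplus>i\<in>E. (if i \<in> E then c i else 0) \<odot> i)"
    using E_carrier by (intro finsum_cong') auto
  then show ?thesis
    unfolding coord_def using lincomb_in_carrier[of E c]
    by (intro the1_equality lincomb_unique) auto
qed

lemma coord_add:
  assumes "a \<in> carrier A" "b \<in> carrier A"
  shows "coord (a \<oplus> b) i = coord a i + coord b i"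
proof -
  have "a \<oplus> b = (\<Oplus>i\<in>E. coord a i \<odot> i) \<oplus> (\<Oplus>i\<in>E. coord b i \<odot> i)"
    using assms by (simp add: coord_expand)
  also have "\<dots> = (\<Oplus>i\<in>E. coord a i \<odot> i \<oplus> coord b i \<odot> i)"
    using E_carrier by (intro finsum_addf[symmetric]) auto
  also have "\<dots> = (\<Oplus>i\<in>E. (coord a i + coord b i) \<odot> i)"
    using E_carrier smult_l_distr by (intro finsum_cong') auto
  finally show ?thesis using assms by (simp add: coord_lincomb coord_outside)
qed

lemma coord_smult:
  assumes "a \<in> carrier A"
  shows "coord (c \<odot> a) i = c * coord a i"
proof -
  have "c \<odot> a = c \<odot> lincomb (coord a) E" using assms by (simp add: coord_expand lincomb_def)
  also have "\<dots> = lincomb (\<lambda>i. c * coord a i) E"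
    using lincomb_smult[OF E_carrier, of "coord a" c] by simp
  finally show ?thesis using assms by (simp add: lincomb_def coord_lincomb coord_outside)
qed

lemma coord_basis:
  assumes "e \<in> E" shows "coord e = unit_vector e"
proof -
  have "(\<Oplus>i\<in>E. unit_vector e i \<odot> i) = (\<Oplus>i\<in>E. if e = i then i else \<zero>)"
    using E_carrier by (intro finsum_cong') (auto simp: lmult_0[simplified] smult_one[simplified])
  also have "\<dots> = e" using assms finite_E E_carrier by (intro add.finprod_singleton) auto
  finally have "coord e = (\<lambda>i. if i \<in> E then unit_vector e i else 0)" using coord_lincomb by metis
  then show ?thesis using assms by auto
qed

text \<open>
  Applied once in each factor of a product, this reduces the coordinates of \<open>a b\<close> to those of products
  of basis vectors.
\<close>

lemma linear_functional_coord:
  assumes L: "\<And>x y. x \<in> carrier A \<Longrightarrow> y \<in> carrier A \<Longrightarrow> L (x \<oplus> y) = L x + L y"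
    "\<And>c x. x \<in> carrier A \<Longrightarrow> L (c \<odot> x) = c * L x"
    and a: "a \<in> carrier A"
  shows "L a = (\<Sum>i\<in>E. coord a i * L i :: 'k)"
proof -
  have "L (\<Oplus>i\<in>H. coord a i \<odot> i) = (\<Sum>i\<in>H. coord a i * L i)" if "H \<subseteq> E" for H
    using finite_subset[OF that finite_E] that
  proof (induction H)
    case empty
    show ?case using L(2)[of \<zero> 0] by simp
  next
    case (insert i H)
    have "i \<in> carrier A" "H \<subseteq> carrier A" using insert E_carrier by auto
    moreover have "(\<Oplus>j\<in>insert i H. coord a j \<odot> j) = coord a i \<odot> i \<oplus> (\<Oplus>j\<in>H. coord a j \<odot> j)"
      using insert calculation by (intro finsum_insert) auto
    ultimately show ?case using insert L lincomb_in_carrier[of H "coord a"] by simp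
  qed
  from this[of E] show ?thesis using a by (simp add: coord_expand)
qed

lemma coord_mult:
  assumes a: "a \<in> carrier A" and b: "b \<in> carrier A" and k: "k \<in> E"
  shows "coord (a \<otimes> b) k = (\<Sum>i\<in>E. \<Sum>j\<in>E. coord a i * coord b j * \<gamma> i j k)"
proof -
  have E: "i \<in> carrier A" if "i \<in> E" for i using that E_carrier by auto
  have "coord (a \<otimes> b) k = (\<Sum>i\<in>E. coord a i * coord (i \<otimes> b) k)"
    by (rule linear_functional_coord[OF _ _ a])
      (use b mult_closed mult_add_left mult_smult_left in \<open>simp_all add: coord_add coord_smult\<close>)
  also have "\<dots> = (\<Sum>i\<in>E. coord a i * (\<Sum>j\<in>E. coord b j * coord (i \<otimes> j) k))"
    by (intro sum.cong arg_cong[of _ _ "(*) _"] refl linear_functional_coord[OF _ _ b])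
      (use E mult_closed mult_add_right mult_smult_right in \<open>simp_all add: coord_add coord_smult\<close>)
  also have "\<dots> = (\<Sum>i\<in>E. coord a i * (\<Sum>j\<in>E. coord b j * \<gamma> i j k))"
  proof (intro sum.cong arg_cong[of _ _ "(*) _"] refl)
    fix i j assume "i \<in> E" "j \<in> E"
    then have "i \<otimes> j = (\<Oplus>l\<in>E. \<gamma> i j l \<odot> l)"
      using structure_constants by (simp add: structure_constants_def)
    then show "coord (i \<otimes> j) k = \<gamma> i j k" using k by (simp add: coord_lincomb)
  qed
  finally show ?thesis by (simp add: sum_distrib_left mult.assoc)
qed

abbreviation "pairs \<equiv> carrier A \<times> (UNIV :: 'f set)"
abbreviation "G \<equiv> free_Abelian_group pairs"
abbreviation "N \<equiv> tensor_null class_ring class_ring \<iota> A"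
abbreviation "C \<equiv> coordinate_algebra E (\<lambda>i j k. \<iota> (\<gamma> i j k))"

text \<open>
  The coordinate of a formal sum along \<open>e\<close>: the pair \<open>(a, r)\<close> stands for the pure tensor of \<open>a\<close> and
  \<open>r\<close>, whose coordinate is \<open>r\<close> times the image of that of \<open>a\<close>.
\<close>

definition tcoord :: "('a \<times> 'f \<Rightarrow>\<^sub>0 int) \<Rightarrow> 'a \<Rightarrow> 'f" where
  "tcoord x e = additive_extension (\<lambda>(a, r). \<iota> (coord a e) * r) x"

text \<open>
  Multiplication and scalar multiplication of formal sums, as they occur in
  \<^const>\<open>scalar_extension\<close>.
\<close>

definition fmult :: "('a \<times> 'f \<Rightarrow>\<^sub>0 int) \<Rightarrow> ('a \<times> 'f \<Rightarrow>\<^sub>0 int) \<Rightarrow> 'a \<times> 'f \<Rightarrow>\<^sub>0 int" where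
  "fmult x y = frag_extend (\<lambda>(a, r). frag_extend (\<lambda>(b, s). frag_of (a \<otimes> b, r * s)) y) x"

definition fsmult :: "'f \<Rightarrow> ('a \<times> 'f \<Rightarrow>\<^sub>0 int) \<Rightarrow> 'a \<times> 'f \<Rightarrow>\<^sub>0 int" where
  "fsmult c x = frag_extend (\<lambda>(a, r). frag_of (a, c * r)) x"

lemma tcoord_simps [simp]:
  "tcoord 0 e = 0" "tcoord (frag_of (a, r)) e = \<iota> (coord a e) * r"
  "tcoord (x + y) e = tcoord x e + tcoord y e" "tcoord (x - y) e = tcoord x e - tcoord y e"
  "tcoord (- x) e = - tcoord x e" "tcoord (sum f I) e = (\<Sum>i\<in>I. tcoord (f i) e)"
  by (simp_all add: tcoord_def additive_extension_sum)

lemma tcoord_outside: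
  assumes "Poly_Mapping.keys x \<subseteq> pairs" "e \<notin> E" shows "tcoord x e = 0"
  using assms(1)
proof (induction x rule: frag_induction)
  case (one p)
  then show ?case using assms(2) by (cases p) (auto simp: coord_outside)
qed simp_all

lemma keys_fmult:
  assumes "Poly_Mapping.keys x \<subseteq> pairs" "Poly_Mapping.keys y \<subseteq> pairs"
  shows "Poly_Mapping.keys (fmult x y) \<subseteq> pairs"
proof -
  have "Poly_Mapping.keys (frag_extend (\<lambda>(b, s). frag_of (a \<otimes> b, r * s)) y) \<subseteq> pairs"
    if "a \<in> carrier A" for a r
    using assms(2) that mult_closed by (intro order_trans[OF keys_frag_extend]) auto
  then have "Poly_Mapping.keys (case p of (a, r) \<Rightarrow>
      frag_extend (\<lambda>(b, s). frag_of (a \<otimes> b, r * s)) y) \<subseteq> pairs" if "p \<in> Poly_Mapping.keys x" for p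
    using subsetD[OF assms(1) that] by (cases p) simp
  then show ?thesis
    unfolding fmult_def by (intro order_trans[OF keys_frag_extend] UN_least)
qed

lemma keys_fsmult:
  assumes "Poly_Mapping.keys x \<subseteq> pairs" shows "Poly_Mapping.keys (fsmult c x) \<subseteq> pairs"
  unfolding fsmult_def using assms by (intro order_trans[OF keys_frag_extend]) auto

lemma tcoord_fsmult:
  assumes "Poly_Mapping.keys x \<subseteq> pairs"
  shows "tcoord (fsmult c x) e = c * tcoord x e"
  using assms
proof (induction x rule: frag_induction)
  case (one p)
  then show ?case by (cases p) (simp add: fsmult_def)
qed (simp_all add: fsmult_def frag_extend_diff right_diff_distrib)

text \<open>
  Both sides are additive in \<open>x\<close> and in \<open>y\<close>, so it suffices to compare them on pairs, where the claim is
  the coordinate formula for products in \<open>A\<close>.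
\<close>

lemma tcoord_fmult:
  assumes x: "Poly_Mapping.keys x \<subseteq> pairs" and y: "Poly_Mapping.keys y \<subseteq> pairs" and k: "k \<in> E"
  shows "tcoord (fmult x y) k = (\<Sum>i\<in>E. \<Sum>j\<in>E. tcoord x i * tcoord y j * \<iota> (\<gamma> i j k))"
  using x
proof (induction x rule: frag_induction)
  case (one p)
  then obtain a r where p: "p = (a, r)" and a: "a \<in> carrier A" by auto
  show ?case
    using y
  proof (induction y rule: frag_induction)
    case (one q)
    then obtain b s where q: "q = (b, s)" and b: "b \<in> carrier A" by auto
    show ?case
      by (simp add: fmult_def p q coord_mult[OF a b k] hom_distribs sum_distrib_right algebra_simps)
  next
    case (diff y z)
    then show ?case
      by (simp add: fmult_def p frag_extend_diff right_diff_distrib left_diff_distrib sum_subtractf)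
  qed (simp add: fmult_def p)
next
  case (diff x z)
  then show ?case
    by (simp add: fmult_def frag_extend_diff left_diff_distrib sum_subtractf)
qed (simp add: fmult_def)

lemma relators_cases:
  assumes "z \<in> tensor_relators class_ring class_ring \<iota> A"
  obtains (left) a b r where "a \<in> carrier A" "b \<in> carrier A"
      "z = frag_of (a \<oplus> b, r) - frag_of (a, r) - frag_of (b, r)"
    | (right) a r s where "a \<in> carrier A" "z = frag_of (a, r + s) - frag_of (a, r) - frag_of (a, s)"
    | (balance) c a r where "a \<in> carrier A" "z = frag_of (c \<odot> a, r) - frag_of (a, \<iota> c * r)"
  using assms unfolding tensor_relators_def by auto

lemma relators_carrier:
  assumes "z \<in> tensor_relators class_ring class_ring \<iota> A" shows "Poly_Mapping.keys z \<subseteq> pairs"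
  using assms
proof (cases rule: relators_cases)
  case (left a b r)
  then show ?thesis by (auto dest!: subsetD[OF keys_diff])
next
  case (right a r s)
  then show ?thesis by (auto dest!: subsetD[OF keys_diff])
next
  case (balance c a r)
  then show ?thesis by (auto dest!: subsetD[OF keys_diff])
qed

lemma tcoord_relators:
  assumes "z \<in> tensor_relators class_ring class_ring \<iota> A" shows "tcoord z e = 0"
  using assms
  by (cases rule: relators_cases) (simp_all add: coord_add coord_smult hom_distribs distrib_left distrib_right mult.assoc)

lemma N_tcoord: "z \<in> N \<Longrightarrow> Poly_Mapping.keys z \<subseteq> pairs \<and> tcoord z = (\<lambda>_. 0)"
  unfolding tensor_null_def
proof (induction z rule: generate.induct)
  case (incl h)
  then show ?case using relators_carrier tcoord_relators by auto
next
  case (inv h)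
  then have "Poly_Mapping.keys h \<subseteq> pairs" "tcoord h e = 0" for e using relators_carrier tcoord_relators by auto
  then show ?case by (auto simp: fun_eq_iff)
next
  case (eng g h)
  then show ?case using keys_add[of g h] by (auto simp: fun_eq_iff)
qed (simp add: fun_eq_iff)

lemma N_closed:
  shows N_zero: "0 \<in> N" and N_add: "x \<in> N \<Longrightarrow> y \<in> N \<Longrightarrow> x + y \<in> N"
    and N_relator: "z \<in> tensor_relators class_ring class_ring \<iota> A \<Longrightarrow> z \<in> N"
    and N_minus: "x \<in> N \<Longrightarrow> - x \<in> N" and N_diff: "x \<in> N \<Longrightarrow> y \<in> N \<Longrightarrow> x - y \<in> N"
proof -
  show "0 \<in> N" using generate.one[of G] by (simp add: tensor_null_def)
  show add: "x + y \<in> N" if "x \<in> N" "y \<in> N" for x y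
    using generate.eng[of x G _ y] that by (simp add: tensor_null_def)
  show "z \<in> tensor_relators class_ring class_ring \<iota> A \<Longrightarrow> z \<in> N"
    by (simp add: tensor_null_def generate.incl)
  have sub: "tensor_relators class_ring class_ring \<iota> A \<subseteq> carrier G" using relators_carrier by auto
  show minus: "- x \<in> N" if "x \<in> N" for x
  proof -
    have "inv\<^bsub>G\<^esub> x \<in> N"
      using group.generate_m_inv_closed[OF group_free_Abelian_group sub] that by (simp add: tensor_null_def)
    then show ?thesis using N_tcoord[OF that] by simp
  qed
  show "x - y \<in> N" if "x \<in> N" "y \<in> N" using add[OF that(1) minus[OF that(2)]] by simp
qed

lemma N_sum: "(\<And>i. i \<in> I \<Longrightarrow> f i \<in> N) \<Longrightarrow> sum f I \<in> N"
  by (induction I rule: infinite_finite_induct) (auto intro: N_zero N_add)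

lemma N_left: "a \<in> carrier A \<Longrightarrow> b \<in> carrier A \<Longrightarrow> frag_of (a \<oplus> b, r) - frag_of (a, r) - frag_of (b, r) \<in> N"
  and N_right: "a \<in> carrier A \<Longrightarrow> frag_of (a, r + s) - frag_of (a, r) - frag_of (a, s) \<in> N"
  and N_balance: "a \<in> carrier A \<Longrightarrow> frag_of (c \<odot> a, r) - frag_of (a, \<iota> c * r) \<in> N"
  by (rule N_relator, unfold tensor_relators_def, force)+

lemma N_scalar_zero: "a \<in> carrier A \<Longrightarrow> frag_of (a, 0) \<in> N"
  using N_minus[OF N_right[of a 0 0]] by simp

lemma N_vector_zero: "frag_of (\<zero>, r) \<in> N"
  using N_minus[OF N_left[of \<zero> \<zero> r]] by simp

text \<open>
  Modulo the relators every formal sum is equal to the one read off from its coordinates. For a pair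
  \<open>(a, r)\<close> one expands \<open>a\<close> in the basis and moves its coefficients to the second component; the class
  of differences is handled by additivity in the second component.
\<close>

lemma tensor_expand:
  assumes "Poly_Mapping.keys x \<subseteq> pairs"
  shows "x - (\<Sum>e\<in>E. frag_of (e, tcoord x e)) \<in> N"
  using assms
proof (induction x rule: frag_induction)
  case zero
  have "(\<Sum>e\<in>E. frag_of (e, 0)) \<in> N" using E_carrier by (intro N_sum N_scalar_zero) auto
  then show ?case using N_minus by simp
next
  case (one p)
  then obtain a r where p: "p = (a, r)" and a: "a \<in> carrier A" by auto
  have "frag_of (\<Oplus>e\<in>H. coord a e \<odot> e, r) - (\<Sum>e\<in>H. frag_of (e, \<iota> (coord a e) * r)) \<in> N" if "H \<subseteq> E" for H
    using finite_subset[OF that finite_E] that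
  proof (induction H)
    case empty
    show ?case by (simp add: N_vector_zero)
  next
    case (insert e H)
    let ?s = "\<Oplus>e\<in>H. coord a e \<odot> e"
    have c: "e \<in> carrier A" "H \<subseteq> carrier A" "?s \<in> carrier A"
      using insert E_carrier lincomb_in_carrier[of H] by auto
    have s: "(\<Oplus>j\<in>insert e H. coord a j \<odot> j) = coord a e \<odot> e \<oplus> ?s"
      using insert c by (intro finsum_insert) auto
    have "(frag_of (coord a e \<odot> e \<oplus> ?s, r) - frag_of (coord a e \<odot> e, r) - frag_of (?s, r)) +
        (frag_of (coord a e \<odot> e, r) - frag_of (e, \<iota> (coord a e) * r)) +
        (frag_of (?s, r) - (\<Sum>e\<in>H. frag_of (e, \<iota> (coord a e) * r))) \<in> N"
      using insert c by (intro N_add N_left N_balance) auto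
    then show ?case unfolding s using insert by (simp add: algebra_simps)
  qed
  from this[of E] show ?case using a by (simp add: p coord_expand)
next
  case (diff x y)
  have "(\<Sum>e\<in>E. frag_of (e, (tcoord x e - tcoord y e) + tcoord y e) - frag_of (e, tcoord x e - tcoord y e)
      - frag_of (e, tcoord y e)) \<in> N"
    using E_carrier by (intro N_sum N_right) auto
  from N_add[OF N_diff[OF diff] this] show ?case by (simp add: sum_subtractf sum.distrib algebra_simps)
qed

text \<open>
  The relators have zero coordinates, and conversely a formal sum with zero coordinates is equivalent to
  a sum of pairs \<open>(e, 0)\<close>, each of which is null.
\<close>

lemma N_eq: "N = {z. Poly_Mapping.keys z \<subseteq> pairs \<and> tcoord z = (\<lambda>_. 0)}"
proof (intro equalityI subsetI)
  fix z assume "z \<in> {z. Poly_Mapping.keys z \<subseteq> pairs \<and> tcoord z = (\<lambda>_. 0)}"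
  then have z: "Poly_Mapping.keys z \<subseteq> pairs" "tcoord z = (\<lambda>_. 0)" by auto
  have "(\<Sum>e\<in>E. frag_of (e, 0)) \<in> N" using E_carrier by (intro N_sum N_scalar_zero) auto
  from N_add[OF tensor_expand[OF z(1)] this] show "z \<in> N" by (simp add: z(2))
qed (use N_tcoord in auto)

text \<open>
  For \<open>v\<close> vanishing off \<open>E\<close> these sets are the cosets of which the tensor product consists.
\<close>

definition fibre :: "('a \<Rightarrow> 'f) \<Rightarrow> ('a \<times> 'f \<Rightarrow>\<^sub>0 int) set" where
  "fibre v = {x. Poly_Mapping.keys x \<subseteq> pairs \<and> tcoord x = v}"

lemma N_coset:
  assumes "Poly_Mapping.keys x \<subseteq> pairs"
  shows "N #>\<^bsub>G\<^esub> x = fibre (tcoord x)"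
proof (intro equalityI subsetI)
  fix y assume "y \<in> N #>\<^bsub>G\<^esub> x"
  then obtain z where z: "z \<in> N" "y = z + x" by (auto simp: r_coset_def)
  then show "y \<in> fibre (tcoord x)"
    using N_tcoord[OF z(1)] assms keys_add[of z x] by (auto simp: fibre_def fun_eq_iff)
next
  fix y assume y: "y \<in> fibre (tcoord x)"
  then have "y - x \<in> N" using keys_diff[of y x] assms by (auto simp: N_eq fibre_def fun_eq_iff)
  then show "y \<in> N #>\<^bsub>G\<^esub> x" by (auto simp: r_coset_def intro!: bexI[of _ "y - x"])
qed

lemma fibre_nonempty:
  assumes "v \<in> carrier C" shows "\<exists>x. x \<in> fibre v"
proof
  have "Poly_Mapping.keys (\<Sum>e\<in>E. frag_of (e, v e)) \<subseteq> pairs"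
    using E_carrier keys_sum[of "\<lambda>e. frag_of (e, v e)" E] by fastforce
  moreover have "tcoord (\<Sum>e\<in>E. frag_of (e, v e)) = v"
  proof
    fix k
    have "tcoord (\<Sum>e\<in>E. frag_of (e, v e)) k = (\<Sum>e\<in>E. v e * unit_vector k e)"
      by (auto simp: coord_basis intro!: sum.cong)
    then show "tcoord (\<Sum>e\<in>E. frag_of (e, v e)) k = v k" using assms finite_E by simp
  qed
  ultimately show "(\<Sum>e\<in>E. frag_of (e, v e)) \<in> fibre v" by (simp add: fibre_def)
qed

lemma tcoord_in_C: "Poly_Mapping.keys x \<subseteq> pairs \<Longrightarrow> tcoord x \<in> carrier C"
  using tcoord_outside by simp

abbreviation "AF \<equiv> scalar_extension class_ring class_ring \<iota> A"

lemma carrier_AF: "carrier AF = fibre ` carrier C"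
proof -
  have "carrier AF = (\<lambda>x. N #>\<^bsub>G\<^esub> x) ` carrier G"
    by (simp add: scalar_extension_def Let_def carrier_FactGroup)
  also have "\<dots> = (\<lambda>x. fibre (tcoord x)) ` carrier G" using N_coset by (intro image_cong) auto
  also have "\<dots> = fibre ` carrier C"
  proof (intro equalityI subsetI)
    fix S assume "S \<in> fibre ` carrier C"
    then obtain v where v: "v \<in> carrier C" "S = fibre v" by blast
    then obtain x where "x \<in> fibre v" using fibre_nonempty by blast
    then show "S \<in> (\<lambda>x. fibre (tcoord x)) ` carrier G" using v by (auto simp: fibre_def)
  qed (use tcoord_in_C in auto)
  finally show ?thesis .
qed

lemma fibre_add:
  assumes "v \<in> carrier C" "w \<in> carrier C"
  shows "fibre v \<oplus>\<^bsub>AF\<^esub> fibre w = fibre (v \<oplus>\<^bsub>C\<^esub> w)"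
proof -
  have "fibre v \<oplus>\<^bsub>AF\<^esub> fibre w = {x + y | x y. x \<in> fibre v \<and> y \<in> fibre w}"
    by (auto simp: scalar_extension_def Let_def FactGroup_def set_mult_def)
  also have "\<dots> = fibre (v \<oplus>\<^bsub>C\<^esub> w)"
  proof (intro equalityI subsetI)
    fix z assume "z \<in> {x + y | x y. x \<in> fibre v \<and> y \<in> fibre w}"
    then obtain x y where "z = x + y" "x \<in> fibre v" "y \<in> fibre w" by blast
    then show "z \<in> fibre (v \<oplus>\<^bsub>C\<^esub> w)" using keys_add[of x y] by (auto simp: fibre_def fun_eq_iff)
  next
    fix z assume z: "z \<in> fibre (v \<oplus>\<^bsub>C\<^esub> w)"
    obtain x where x: "x \<in> fibre v" using fibre_nonempty assms by blast
    have "z - x \<in> fibre w" using x z keys_diff[of z x] by (auto simp: fibre_def fun_eq_iff)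
    then show "z \<in> {x + y | x y. x \<in> fibre v \<and> y \<in> fibre w}" using x by force
  qed
  finally show ?thesis .
qed

text \<open>
  All the cosets in the union that defines the product coincide, because the coordinates of a product
  of representatives depend only on the coordinates of the factors.
\<close>

lemma fibre_mult:
  assumes "v \<in> carrier C" "w \<in> carrier C"
  shows "fibre v \<otimes>\<^bsub>AF\<^esub> fibre w = fibre (v \<otimes>\<^bsub>C\<^esub> w)"
proof -
  have eq: "N #>\<^bsub>G\<^esub> fmult x y = fibre (v \<otimes>\<^bsub>C\<^esub> w)" if "x \<in> fibre v" "y \<in> fibre w" for x y
  proof -
    have k: "Poly_Mapping.keys x \<subseteq> pairs" "Poly_Mapping.keys y \<subseteq> pairs" and v: "tcoord x = v" "tcoord y = w"
      using that by (auto simp: fibre_def)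
    have "tcoord (fmult x y) = v \<otimes>\<^bsub>C\<^esub> w"
      using tcoord_fmult[OF k] tcoord_outside[OF keys_fmult[OF k]] by (auto simp: v fun_eq_iff)
    then show ?thesis using N_coset[OF keys_fmult[OF k]] by simp
  qed
  have "fibre v \<otimes>\<^bsub>AF\<^esub> fibre w = (\<Union>x\<in>fibre v. \<Union>y\<in>fibre w. N #>\<^bsub>G\<^esub> fmult x y)"
    by (simp add: scalar_extension_def Let_def fmult_def)
  also have "\<dots> = fibre (v \<otimes>\<^bsub>C\<^esub> w)"
    using eq fibre_nonempty[OF assms(1)] fibre_nonempty[OF assms(2)] by auto
  finally show ?thesis .
qed

lemma fibre_smult:
  assumes "v \<in> carrier C"
  shows "c \<odot>\<^bsub>AF\<^esub> fibre v = fibre (c \<odot>\<^bsub>C\<^esub> v)"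
proof -
  have eq: "N #>\<^bsub>G\<^esub> fsmult c x = fibre (c \<odot>\<^bsub>C\<^esub> v)" if "x \<in> fibre v" for x
  proof -
    have k: "Poly_Mapping.keys x \<subseteq> pairs" and v: "tcoord x = v" using that by (auto simp: fibre_def)
    have "tcoord (fsmult c x) = c \<odot>\<^bsub>C\<^esub> v" using tcoord_fsmult[OF k] by (auto simp: v fun_eq_iff)
    then show ?thesis using N_coset[OF keys_fsmult[OF k]] by simp
  qed
  have "c \<odot>\<^bsub>AF\<^esub> fibre v = (\<Union>x\<in>fibre v. N #>\<^bsub>G\<^esub> fsmult c x)"
    by (simp add: scalar_extension_def Let_def fsmult_def)
  also have "\<dots> = fibre (c \<odot>\<^bsub>C\<^esub> v)" using eq fibre_nonempty[OF assms] by auto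
  finally show ?thesis .
qed

lemma scalar_extension_iso_coordinates: "algebra_isomorphic class_ring C AF"
proof -
  have "inj_on fibre (carrier C)"
  proof (rule inj_onI)
    fix v w assume "v \<in> carrier C" "fibre v = fibre w"
    then obtain x where "x \<in> fibre v" "x \<in> fibre w" using fibre_nonempty by metis
    then show "v = w" by (simp add: fibre_def)
  qed
  then have "bij_betw fibre (carrier C) (carrier AF)" by (simp add: carrier_AF bij_betw_def)
  moreover have "fibre \<in> module_hom class_ring C AF"
    unfolding module_hom_def using fibre_add fibre_smult by (simp add: carrier_AF)
  ultimately show ?thesis unfolding algebra_isomorphic_def using fibre_mult by blast
qed

end

section \<open>Transfer of isomorphisms\<close>

text \<open>
  The subfield \<open>K\<^sub>0\<close> of elements sent by \<open>\<iota>\<^sub>2\<close> into \<open>S\<close> contains all structure constants. Its copy in \<open>F\<^sub>1\<close>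
  maps to \<open>S\<close> by undoing \<open>\<iota>\<^sub>1\<close> and applying \<open>\<iota>\<^sub>2\<close>, and an extension of this map to the finitely many matrix
  entries turns the solution over \<open>F\<^sub>1\<close> into one over \<open>S\<close>.
\<close>

lemma isomorphism_matrices_transfer:
  fixes \<iota>\<^sub>1 :: "'k::field \<Rightarrow> 'f1::field" and \<iota>\<^sub>2 :: "'k \<Rightarrow> 'f2::field"
  assumes \<iota>\<^sub>1: "field_hom \<iota>\<^sub>1" and \<iota>\<^sub>2: "field_hom \<iota>\<^sub>2"
    and S: "root_closed_subring S"
    and I: "finite I" and J: "finite J"
    and \<gamma>: "\<forall>i\<in>I. \<forall>j\<in>I. \<forall>k\<in>I. \<iota>\<^sub>2 (\<gamma> i j k) \<in> S" and \<delta>: "\<forall>i\<in>J. \<forall>j\<in>J. \<forall>k\<in>J. \<iota>\<^sub>2 (\<delta> i j k) \<in> S"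
    and PQ: "isomorphism_matrices I J (\<lambda>i j k. \<iota>\<^sub>1 (\<gamma> i j k)) (\<lambda>i j k. \<iota>\<^sub>1 (\<delta> i j k)) P Q"
  shows "\<exists>P' Q'. isomorphism_matrices I J (\<lambda>i j k. \<iota>\<^sub>2 (\<gamma> i j k)) (\<lambda>i j k. \<iota>\<^sub>2 (\<delta> i j k)) P' Q'"
proof -
  interpret h1: field_hom \<iota>\<^sub>1 by (rule \<iota>\<^sub>1)
  interpret h2: field_hom \<iota>\<^sub>2 by (rule \<iota>\<^sub>2)
  have Ssub: "is_subring S" using S by (simp add: root_closed_subring_def)
  have inj: "inj \<iota>\<^sub>1" by (rule injI) simp
  define K\<^sub>0 where "K\<^sub>0 = {c. \<iota>\<^sub>2 c \<in> S}"
  define f where "f y = \<iota>\<^sub>2 (inv_into UNIV \<iota>\<^sub>1 y)" for y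
  have f: "f (\<iota>\<^sub>1 c) = \<iota>\<^sub>2 c" for c unfolding f_def using inj by simp
  have K\<^sub>0: "c - d \<in> K\<^sub>0" "c * d \<in> K\<^sub>0" "inverse c \<in> K\<^sub>0" if "c \<in> K\<^sub>0" "d \<in> K\<^sub>0" for c d
    using that subring_diff[OF Ssub] subring_mult[OF Ssub] root_closed_subring_inverse[OF S]
    by (simp_all add: K\<^sub>0_def hom_distribs)
  have "1 \<in> K\<^sub>0" using subring_one[OF Ssub] by (simp add: K\<^sub>0_def)
  then have "1 \<in> \<iota>\<^sub>1 ` K\<^sub>0" by (metis h1.hom_one image_eqI)
  moreover have "x - y \<in> \<iota>\<^sub>1 ` K\<^sub>0" "x * y \<in> \<iota>\<^sub>1 ` K\<^sub>0" if "x \<in> \<iota>\<^sub>1 ` K\<^sub>0" "y \<in> \<iota>\<^sub>1 ` K\<^sub>0" for x y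
    using that K\<^sub>0(1,2) by (auto simp flip: h1.hom_minus h1.hom_mult)
  ultimately have "is_subring (\<iota>\<^sub>1 ` K\<^sub>0)" by (simp add: is_subring_def)
  moreover have "f 1 = 1" using f[of 1] by simp
  moreover have "f (x + y) = f x + f y" "f (x * y) = f x * f y" if "x \<in> \<iota>\<^sub>1 ` K\<^sub>0" "y \<in> \<iota>\<^sub>1 ` K\<^sub>0" for x y
    using that by (auto simp: f hom_distribs simp flip: h1.hom_add h1.hom_mult)
  ultimately have hom: "subring_hom (\<iota>\<^sub>1 ` K\<^sub>0) S f"
    unfolding subring_hom_def by (auto simp: f K\<^sub>0_def)
  have inv': "inverse r \<in> \<iota>\<^sub>1 ` K\<^sub>0" if "r \<in> \<iota>\<^sub>1 ` K\<^sub>0" for r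
    using that K\<^sub>0(3) by (auto simp flip: h1.hom_inverse)
  define H where "H = (\<lambda>(i, j). P i j) ` (I \<times> J) \<union> (\<lambda>(j, i). Q j i) ` (J \<times> I)"
  have "finite H" using I J by (simp add: H_def)
  from subfield_hom_extension[OF hom inv' S this] obtain T g where
    T: "\<iota>\<^sub>1 ` K\<^sub>0 \<union> H \<subseteq> T" and g: "subring_hom T S g" and gf: "\<forall>r\<in>\<iota>\<^sub>1 ` K\<^sub>0. g r = f r" by blast
  have PQT: "P i j \<in> T \<and> Q j i \<in> T" if "i \<in> I" "j \<in> J" for i j
    using T that by (auto simp: H_def)
  have T\<^sub>0: "\<iota>\<^sub>1 c \<in> T" "g (\<iota>\<^sub>1 c) = \<iota>\<^sub>2 c" if "\<iota>\<^sub>2 c \<in> S" for c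
    using T gf f that by (auto simp: K\<^sub>0_def)
  have "isomorphism_matrices I J (\<lambda>i j k. g (\<iota>\<^sub>1 (\<gamma> i j k))) (\<lambda>i j k. g (\<iota>\<^sub>1 (\<delta> i j k)))
      (\<lambda>i j. g (P i j)) (\<lambda>j i. g (Q j i))"
    by (rule isomorphism_matrices_hom[OF g PQ PQT]) (use \<gamma> \<delta> T\<^sub>0(1) in auto)
  then have "isomorphism_matrices I J (\<lambda>i j k. \<iota>\<^sub>2 (\<gamma> i j k)) (\<lambda>i j k. \<iota>\<^sub>2 (\<delta> i j k))
      (\<lambda>i j. g (P i j)) (\<lambda>j i. g (Q j i))"
    unfolding isomorphism_matrices_def using \<gamma> \<delta> T\<^sub>0(2) by simp
  then show ?thesis by blast
qed

theorem corollary4p7: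
  fixes \<iota>\<^sub>1 :: "'k::field \<Rightarrow> 'f1::field" and \<iota>\<^sub>2 :: "'k \<Rightarrow> 'f2::field"
    and Qbar :: "'f2 set"
    and A :: "('k, 'a) module" and E\<^sub>A :: "'a set" and \<gamma>\<^sub>A :: "'a \<Rightarrow> 'a \<Rightarrow> 'a \<Rightarrow> 'k"
    and B :: "('k, 'b) module" and E\<^sub>B :: "'b set" and \<gamma>\<^sub>B :: "'b \<Rightarrow> 'b \<Rightarrow> 'b \<Rightarrow> 'k"
  assumes "field_hom \<iota>\<^sub>1"
    and "field_hom \<iota>\<^sub>2"
    and "algebraic_closure (class_ring\<lparr>carrier := Qbar\<rparr>) (\<iota>\<^sub>2 ` prime_field class_ring)"
    and "nonassoc_algebra class_ring A" and "vectorspace.fin_dim class_ring A"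
    and "nonassoc_algebra class_ring B" and "vectorspace.fin_dim class_ring B"
    and "vectorspace.basis class_ring A E\<^sub>A" and "structure_constants class_ring A E\<^sub>A \<gamma>\<^sub>A"
    and "\<forall>e\<in>E\<^sub>A. \<forall>e'\<in>E\<^sub>A. \<forall>e''\<in>E\<^sub>A. \<iota>\<^sub>2 (\<gamma>\<^sub>A e e' e'') \<in> Qbar"
    and "vectorspace.basis class_ring B E\<^sub>B" and "structure_constants class_ring B E\<^sub>B \<gamma>\<^sub>B"
    and "\<forall>e\<in>E\<^sub>B. \<forall>e'\<in>E\<^sub>B. \<forall>e''\<in>E\<^sub>B. \<iota>\<^sub>2 (\<gamma>\<^sub>B e e' e'') \<in> Qbar"
    and "algebra_isomorphic class_ring
           (scalar_extension class_ring class_ring \<iota>\<^sub>1 A) (scalar_extension class_ring class_ring \<iota>\<^sub>1 B)"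
  shows "algebra_isomorphic class_ring
           (scalar_extension class_ring class_ring \<iota>\<^sub>2 A) (scalar_extension class_ring class_ring \<iota>\<^sub>2 B)"
proof -
  have A1: "based_algebra A \<iota>\<^sub>1 E\<^sub>A \<gamma>\<^sub>A" and A2: "based_algebra A \<iota>\<^sub>2 E\<^sub>A \<gamma>\<^sub>A"
    and B1: "based_algebra B \<iota>\<^sub>1 E\<^sub>B \<gamma>\<^sub>B" and B2: "based_algebra B \<iota>\<^sub>2 E\<^sub>B \<gamma>\<^sub>B"
    using assms by (simp_all add: based_algebra_def based_algebra_axioms_def)
  have fin: "finite E\<^sub>A" "finite E\<^sub>B"
    using based_algebra.finite_E[OF A1] based_algebra.finite_E[OF B1] .
  let ?A1 = "coordinate_algebra E\<^sub>A (\<lambda>i j k. \<iota>\<^sub>1 (\<gamma>\<^sub>A i j k))"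
  let ?A2 = "coordinate_algebra E\<^sub>A (\<lambda>i j k. \<iota>\<^sub>2 (\<gamma>\<^sub>A i j k))"
  let ?B1 = "coordinate_algebra E\<^sub>B (\<lambda>i j k. \<iota>\<^sub>1 (\<gamma>\<^sub>B i j k))"
  let ?B2 = "coordinate_algebra E\<^sub>B (\<lambda>i j k. \<iota>\<^sub>2 (\<gamma>\<^sub>B i j k))"
  note iso = based_algebra.scalar_extension_iso_coordinates
  note sym = algebra_isomorphic_from_coordinates_sym
  have "algebra_isomorphic class_ring ?A1 ?B1"
    by (rule algebra_isomorphic_trans[OF iso[OF A1]
          algebra_isomorphic_trans[OF assms(14) sym[OF iso[OF B1]]]])
  then obtain P Q where "isomorphism_matrices E\<^sub>A E\<^sub>B
      (\<lambda>i j k. \<iota>\<^sub>1 (\<gamma>\<^sub>A i j k)) (\<lambda>i j k. \<iota>\<^sub>1 (\<gamma>\<^sub>B i j k)) P Q"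
    using coordinate_algebra_iso_imp_matrices[OF fin] by blast
  then obtain P' Q' where "isomorphism_matrices E\<^sub>A E\<^sub>B
      (\<lambda>i j k. \<iota>\<^sub>2 (\<gamma>\<^sub>A i j k)) (\<lambda>i j k. \<iota>\<^sub>2 (\<gamma>\<^sub>B i j k)) P' Q'"
    using isomorphism_matrices_transfer[OF assms(1,2) algebraic_closure_root_closed[OF assms(3)] fin assms(10,13)] by blast
  then have "algebra_isomorphic class_ring ?A2 ?B2"
    by (rule matrices_imp_coordinate_algebra_iso[OF fin])
  then show ?thesis
    by (rule algebra_isomorphic_trans[OF sym[OF iso[OF A2]] algebra_isomorphic_trans[OF _ iso[OF B2]]])
qed

end
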